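(* Let $n\ge 1$. Regard $W(n)$ as a $W(1)$-module via $x\cdot D=[\Theta_W(x),D]$, where $\Theta_W(x_1^i\partial_1)=x_1^i\partial_1$. Then as $W(1)$-modules $$W(n)\cong V(p-1)^{\oplus(n-1)p^{n-1}}\oplus L(p-2)^{\oplus p^{n-1}},$$ and hence $$[W(n)]=(n-1)p^{n-1}\big([L(0)]+[L(p-1)]\big)+p^{n-1}[L(p-2)].$$
   Context: $\mathbb F$ is an algebraically closed field of characteristic $p>2$, $I=\{0,\dots,p-1\}$. $\mathcal A(n)$ is the truncated polynomial algebra with basis $x^\alpha$, $\alpha\in I^n$, $x^\alpha x^\beta=x^{\alpha+\beta}$ ($=0$ if $\alpha+\beta\notin I^n$). $W(n)$ is the derivation algebra of $\mathcal A(n)$, a free $\mathcal A(n)$-module on $\partial_1,\dots,\partial_n$ with $\partial_i(x_j)=\delta_{ij}$; $W(1)$ is the Witt algebra with basis $x_1^i\partial_1$, $i\in I$, a restricted Lie algebra (p-map: $p$-th power). $W(1)$ is graded by $W(1)_{[i]}=\mathbb F x_1^{i+1}\partial_1$, $-1\le i\le p-2$; set $W(1)_0=\bigoplus_{i\ge 0}W(1)_{[i]}$, $W(1)_1=\bigoplus_{i\ge1}W(1)_{[i]}$. For $\lambda\in I$, $\mathbb F_\lambda$ is the one-dimensional $W(1)_0$-module on which $x_1\partial_1$ acts by $\lambda$ and $W(1)_1$ acts by $0$; the restricted baby Verma module is $V(\lambda)=u(W(1))\otimes_{u(W(1)_0)}\mathbb F_\lambda$, where $u(\cdot)$ is the restricted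 enveloping algebra, and $L(\lambda)$ is its unique simple quotient. For a module $M$, $[M]$ denotes the formal sum of its composition factors (with multiplicity). *)

theory Defs
  imports "HOL-Computational_Algebra.Polynomial"
begin

definition vzero :: "'b \<Rightarrow> 'a::field" where "vzero = (\<lambda>_. 0)"
definition vadd :: "('b \<Rightarrow> 'a::field) \<Rightarrow> ('b \<Rightarrow> 'a) \<Rightarrow> ('b \<Rightarrow> 'a)" where
  "vadd f g = (\<lambda>x. f x + g x)"
definition vdiff :: "('b \<Rightarrow> 'a::field) \<Rightarrow> ('b \<Rightarrow> 'a) \<Rightarrow> ('b \<Rightarrow> 'a)" where
  "vdiff f g = (\<lambda>x. f x - g x)"
definition vsc :: "'a::field \<Rightarrow> ('b \<Rightarrow> 'a) \<Rightarrow> ('b \<Rightarrow> 'a)" where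
  "vsc c f = (\<lambda>x. c * f x)"
definition vsum :: "(nat \<Rightarrow> 'b \<Rightarrow> 'a::field) \<Rightarrow> nat \<Rightarrow> ('b \<Rightarrow> 'a)" where
  "vsum k N = (\<lambda>x. \<Sum>t<N. k t x)"

definition subspace :: "('b \<Rightarrow> 'a::field) set \<Rightarrow> bool" where
  "subspace S \<longleftrightarrow> vzero \<in> S \<and> (\<forall>u\<in>S. \<forall>v\<in>S. vadd u v \<in> S) \<and> (\<forall>c. \<forall>v\<in>S. vsc c v \<in> S)"

definition lin_on :: "('b \<Rightarrow> 'a::field) set \<Rightarrow> (('b \<Rightarrow> 'a) \<Rightarrow> ('c \<Rightarrow> 'a)) \<Rightarrow> bool" where
  "lin_on S f \<longleftrightarrow> (\<forall>u\<in>S. \<forall>v\<in>S. f (vadd u v) = vadd (f u) (f v)) \<and>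
                  (\<forall>c. \<forall>v\<in>S. f (vsc c v) = vsc c (f v))"

section \<open>W(1)-modules. A module is a carrier C with the actions rho i of the basis
  elements x_1^i \<partial>_1 (i < p) of W(1).\<close>

definition submodule :: "nat \<Rightarrow> (nat \<Rightarrow> ('b \<Rightarrow> 'a::field) \<Rightarrow> ('b \<Rightarrow> 'a)) \<Rightarrow> ('b \<Rightarrow> 'a) set \<Rightarrow> ('b \<Rightarrow> 'a) set \<Rightarrow> bool" where
  "submodule p \<rho> C N \<longleftrightarrow> N \<subseteq> C \<and> subspace N \<and> (\<forall>i<p. \<forall>v\<in>N. \<rho> i v \<in> N)"

section \<open>Baby Verma module V(lambda), on its PBW basis v_j = \<partial>^j \<otimes> 1, 0 \<le> j < p\<close>

definition Vcar :: "nat \<Rightarrow> (nat \<Rightarrow> 'a::field) set" where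
  "Vcar p = {v. \<forall>m\<ge>p. v m = 0}"

text \<open>x^i \<partial> . v_j = (-1)^i i! (binom j i - lambda binom j (i-1)) v_(j-i+1)\<close>
definition cV :: "nat \<Rightarrow> nat \<Rightarrow> nat \<Rightarrow> 'a::field" where
  "cV lam i j = (-1) ^ i * of_nat (fact i) *
      (of_nat (j choose i) - (if i = 0 then 0 else of_nat lam * of_nat (j choose (i - 1))))"

definition \<rho>V :: "nat \<Rightarrow> nat \<Rightarrow> nat \<Rightarrow> (nat \<Rightarrow> 'a::field) \<Rightarrow> (nat \<Rightarrow> 'a)" where
  "\<rho>V p lam i v = (\<lambda>m. if m < p \<and> 1 \<le> m + i \<and> m + i - 1 < p
                         then cV lam i (m + i - 1) * v (m + i - 1) else 0)"

definition iso_V :: "nat \<Rightarrow> nat \<Rightarrow> (nat \<Rightarrow> ('b \<Rightarrow> 'a::field) \<Rightarrow> ('b \<Rightarrow> 'a)) \<Rightarrow> ('b \<Rightarrow> 'a) set \<Rightarrow> bool" where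
  "iso_V p lam \<rho> K \<longleftrightarrow> (\<exists>f. lin_on (Vcar p) f \<and> bij_betw f (Vcar p) K \<and>
       (\<forall>i<p. \<forall>v\<in>Vcar p. f (\<rho>V p lam i v) = \<rho> i (f v)))"

definition simple_sq :: "nat \<Rightarrow> (nat \<Rightarrow> ('b \<Rightarrow> 'a::field) \<Rightarrow> ('b \<Rightarrow> 'a)) \<Rightarrow> ('b \<Rightarrow> 'a) set \<Rightarrow> ('b \<Rightarrow> 'a) set \<Rightarrow> ('b \<Rightarrow> 'a) set \<Rightarrow> bool" where
  "simple_sq p \<rho> C N M \<longleftrightarrow> submodule p \<rho> C N \<and> submodule p \<rho> C M \<and> N \<subset> M \<and>
     (\<forall>K. submodule p \<rho> C K \<and> N \<subseteq> K \<and> K \<subseteq> M \<longrightarrow> K = N \<or> K = M)"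

text \<open>The subquotient M/N is isomorphic to L(lambda), the unique simple quotient of V(lambda):
  it is simple and there is a surjective module homomorphism V(lambda) \<rightarrow> M/N.\<close>
definition is_L_sq :: "nat \<Rightarrow> nat \<Rightarrow> (nat \<Rightarrow> ('b \<Rightarrow> 'a::field) \<Rightarrow> ('b \<Rightarrow> 'a)) \<Rightarrow> ('b \<Rightarrow> 'a) set \<Rightarrow> ('b \<Rightarrow> 'a) set \<Rightarrow> ('b \<Rightarrow> 'a) set \<Rightarrow> bool" where
  "is_L_sq p lam \<rho> C N M \<longleftrightarrow> simple_sq p \<rho> C N M \<and>
     (\<exists>f. lin_on (Vcar p) f \<and> f ` Vcar p \<subseteq> M \<and>
        (\<forall>i<p. \<forall>v\<in>Vcar p. vdiff (f (\<rho>V p lam i v)) (\<rho> i (f v)) \<in> N) \<and>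
        (\<forall>m\<in>M. \<exists>v\<in>Vcar p. vdiff m (f v) \<in> N))"

definition comp_series :: "nat \<Rightarrow> (nat \<Rightarrow> ('b \<Rightarrow> 'a::field) \<Rightarrow> ('b \<Rightarrow> 'a)) \<Rightarrow> ('b \<Rightarrow> 'a) set \<Rightarrow> (nat \<Rightarrow> ('b \<Rightarrow> 'a) set) \<Rightarrow> nat \<Rightarrow> bool" where
  "comp_series p \<rho> C M r \<longleftrightarrow> M 0 = {vzero} \<and> M r = C \<and> (\<forall>i<r. simple_sq p \<rho> C (M i) (M (Suc i)))"

text \<open>Exponent vectors alpha in I^n (variables indexed 0..n-1).\<close>
definition Mon :: "nat \<Rightarrow> nat \<Rightarrow> (nat \<Rightarrow> nat) set" where
  "Mon p n = {\<alpha>. (\<forall>i<n. \<alpha> i < p) \<and> (\<forall>i\<ge>n. \<alpha> i = 0)}"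

definition Amul :: "nat \<Rightarrow> nat \<Rightarrow> ((nat \<Rightarrow> nat) \<Rightarrow> 'a::field) \<Rightarrow> ((nat \<Rightarrow> nat) \<Rightarrow> 'a) \<Rightarrow> ((nat \<Rightarrow> nat) \<Rightarrow> 'a)" where
  "Amul p n f g = (\<lambda>\<gamma>. if \<gamma> \<in> Mon p n then
      (\<Sum>\<alpha>\<in>Mon p n. \<Sum>\<beta>\<in>Mon p n. if (\<lambda>i. \<alpha> i + \<beta> i) = \<gamma> then f \<alpha> * g \<beta> else 0) else 0)"

text \<open>Partial derivative \<partial>_(i+1) on A(n).\<close>
definition Apd :: "nat \<Rightarrow> nat \<Rightarrow> nat \<Rightarrow> ((nat \<Rightarrow> nat) \<Rightarrow> 'a::field) \<Rightarrow> ((nat \<Rightarrow> nat) \<Rightarrow> 'a)" where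
  "Apd p n i f = (\<lambda>\<gamma>. if \<gamma> \<in> Mon p n \<and> \<gamma>(i := Suc (\<gamma> i)) \<in> Mon p n
      then of_nat (Suc (\<gamma> i)) * f (\<gamma>(i := Suc (\<gamma> i))) else 0)"

text \<open>An element D = sum_j f_j \<partial>_(j+1) of W(n) is the function (j, gamma) \<mapsto> coefficient of x^gamma in f_j.\<close>
definition Wcar :: "nat \<Rightarrow> nat \<Rightarrow> (nat \<times> (nat \<Rightarrow> nat) \<Rightarrow> 'a::field) set" where
  "Wcar p n = {D. \<forall>j \<gamma>. (n \<le> j \<or> \<gamma> \<notin> Mon p n) \<longrightarrow> D (j, \<gamma>) = 0}"

definition Wbr :: "nat \<Rightarrow> nat \<Rightarrow> (nat \<times> (nat \<Rightarrow> nat) \<Rightarrow> 'a::field) \<Rightarrow> (nat \<times> (nat \<Rightarrow> nat) \<Rightarrow> 'a) \<Rightarrow> (nat \<times> (nat \<Rightarrow> nat) \<Rightarrow> 'a)" where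
  "Wbr p n D E = (\<lambda>(j, \<gamma>). \<Sum>i<n.
      Amul p n (\<lambda>\<beta>. D (i, \<beta>)) (Apd p n i (\<lambda>\<beta>. E (j, \<beta>))) \<gamma>
    - Amul p n (\<lambda>\<beta>. E (i, \<beta>)) (Apd p n i (\<lambda>\<beta>. D (j, \<beta>))) \<gamma>)"

definition Wth :: "nat \<Rightarrow> nat \<Rightarrow> nat \<Rightarrow> (nat \<times> (nat \<Rightarrow> nat) \<Rightarrow> 'a::field)" where
  "Wth p n k = (\<lambda>(j, \<gamma>). if j = 0 \<and> \<gamma> = (\<lambda>i. if i = 0 then k else 0) then 1 else 0)"

definition \<rho>W :: "nat \<Rightarrow> nat \<Rightarrow> nat \<Rightarrow> (nat \<times> (nat \<Rightarrow> nat) \<Rightarrow> 'a::field) \<Rightarrow> (nat \<times> (nat \<Rightarrow> nat) \<Rightarrow> 'a)" where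
  "\<rho>W p n k D = Wbr p n (Wth p n k) D"

definition mult_L :: "nat \<Rightarrow> nat \<Rightarrow> nat \<Rightarrow> nat" where
  "mult_L p n lam = (if lam = 0 then (n - 1) * p ^ (n - 1) else 0)
                  + (if lam = p - 1 then (n - 1) * p ^ (n - 1) else 0)
                  + (if lam = p - 2 then p ^ (n - 1) else 0)"

end

theory Submission
  imports Defs "HOL-Library.FuncSet"
begin

text \<open>In the monomial basis, \<open>x\<^sub>1\<^sup>k \<partial>\<^sub>1\<close> sends \<open>x\<^sub>1\<^sup>a y\<^sup>\<beta> \<partial>\<^sub>j\<close> to
  \<open>(a - s k) x\<^sub>1\<^sup>a\<^sup>+\<^sup>k\<^sup>-\<^sup>1 y\<^sup>\<beta> \<partial>\<^sub>j\<close>, where \<open>s = 1\<close> if \<open>j = 1\<close> and \<open>s = 0\<close> otherwise.  So \<open>W(n)\<close> is the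
  direct sum of the blocks with fixed \<open>(j, \<beta>)\<close>.  The blocks with \<open>j = 1\<close> are copies of the adjoint
  module \<open>W(1)\<close>, which is simple with highest weight vector \<open>x\<^sup>p\<^sup>-\<^sup>1 \<partial>\<close> of weight \<open>p - 2\<close>; the others
  are copies of \<open>A(1)\<close>, which is generated by \<open>x\<^sup>p\<^sup>-\<^sup>1\<close> and is isomorphic to \<open>V(p - 1)\<close>, with composition
  factors the constants \<open>L(0)\<close> and the quotient \<open>L(p - 1)\<close>.  The label of a simple factor is the weight
  of its vector killed by \<open>W(1)\<^sub>1\<close>, and the multiplicities do not depend on the composition series by
  the Jordan-Hoelder argument.\<close>

section \<open>Composition series\<close>

text \<open>The count is claimed for every composition series, so a label must be moved between
  subquotients of unrelated series, and it must be the only possible one. No quotient module is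
  formed: a map to \<open>M/N\<close> is a linear map to \<open>M\<close> that intertwines modulo
  \<open>N\<close>. Uniqueness of labels is proved only in one explicit series spanned by monomials,
  where the vectors killed by \<open>W(1)_1\<close> can be computed by coordinates; the matching of
  factors carries the counts to every other series.

  The weights \<open>p - 1\<close> and \<open>p - 2\<close> have one origin. With \<open>s\<close>
  as in the overview, \<open>x_1 \<partial>_1\<close> acts on the monomial with
  \<open>x_1\<close>-exponent \<open>p - 1\<close> by \<open>p - 1 - s\<close>, and sending
  \<open>v_0\<close> to that monomial identifies \<open>V(p - 1 - s)\<close> with the whole block.
  The constants \<open>(-1)^m m!\<close> of this isomorphism are nonzero because
  \<open>m < p\<close>. For \<open>s = 1\<close> it shows that \<open>L(p - 2)\<close> is all of
  \<open>V(p - 2)\<close>. The bound \<open>p > 2\<close> makes 2 invertible, which the simplicity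
  of \<open>W(1)\<close> rests on, and keeps the labels 0, \<open>p - 2\<close>,
  \<open>p - 1\<close> distinct.\<close>

lemmas vdefs = vzero_def vadd_def vdiff_def vsc_def vsum_def

definition unit_vec :: "'b \<Rightarrow> 'b \<Rightarrow> 'a::field" where
  "unit_vec m = (\<lambda>x. if x = m then 1 else 0)"

lemma subspace_vzero: "subspace S \<Longrightarrow> vzero \<in> S"
  and subspace_vadd: "subspace S \<Longrightarrow> u \<in> S \<Longrightarrow> v \<in> S \<Longrightarrow> vadd u v \<in> S"
  and subspace_vsc: "subspace S \<Longrightarrow> v \<in> S \<Longrightarrow> vsc c v \<in> S"
  by (auto simp: subspace_def)

lemma subspace_vdiff:
  assumes "subspace S" "u \<in> S" "v \<in> S"
  shows "vdiff u v \<in> S"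
proof -
  have "vdiff u v = vadd u (vsc (-1) v)"
    by (simp add: vdefs)
  then show ?thesis
    using assms by (simp add: subspace_vadd subspace_vsc)
qed

lemma subspace_lincomb:
  fixes N :: nat
  assumes "subspace S" "\<And>m. m < N \<Longrightarrow> u m \<in> S"
  shows "(\<lambda>x. \<Sum>m<N. c m * u m x) \<in> S"
  using assms(2)
proof (induction N)
  case 0
  then show ?case using subspace_vzero[OF assms(1)] by (simp add: vzero_def)
next
  case (Suc N)
  have "vadd (\<lambda>x. \<Sum>m<N. c m * u m x) (vsc (c N) (u N)) \<in> S"
    using Suc by (intro subspace_vadd subspace_vsc assms(1)) auto
  then show ?case by (simp add: vdefs)
qed

lemma subspace_Vcar: "subspace (Vcar p)"
  by (auto simp: subspace_def Vcar_def vdefs)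

lemma Vcar_lincomb:
  assumes "v \<in> Vcar p"
  shows "v = (\<lambda>x. \<Sum>m<p. v m * unit_vec m x)"
proof
  fix x
  have "(\<Sum>m<p. v m * unit_vec m x) = (\<Sum>m<p. if x = m then v m else 0)"
    by (rule sum.cong) (auto simp: unit_vec_def)
  also have "\<dots> = v x"
    using assms by (auto simp: Vcar_def)
  finally show "v x = (\<Sum>m<p. v m * unit_vec m x)" by simp
qed

lemma unit_vec_in_Vcar: "m < p \<Longrightarrow> unit_vec m \<in> Vcar p"
  by (auto simp: Vcar_def unit_vec_def)

lemma lin_on_vzero:
  assumes "lin_on S f" "subspace S"
  shows "f vzero = vzero"
proof -
  have "f (vsc 0 vzero) = vsc 0 (f vzero)"
    using assms by (auto simp: lin_on_def subspace_vzero)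
  then show ?thesis by (simp add: vdefs)
qed

lemma lin_on_vdiff:
  assumes "lin_on S f" "subspace S" "u \<in> S" "v \<in> S"
  shows "f (vdiff u v) = vdiff (f u) (f v)"
proof -
  have "f (vadd u (vsc (-1) v)) = vadd (f u) (vsc (-1) (f v))"
    using assms by (auto simp: lin_on_def subspace_vsc)
  then show ?thesis by (simp add: vdefs)
qed

lemma lin_on_lincomb:
  fixes N :: nat
  assumes "lin_on S f" "subspace S" "\<And>m. m < N \<Longrightarrow> u m \<in> S"
  shows "f (\<lambda>x. \<Sum>m<N. c m * u m x) = (\<lambda>x. \<Sum>m<N. c m * f (u m) x)"
  using assms(3)
proof (induction N)
  case 0
  then show ?case using lin_on_vzero[OF assms(1,2)] by (simp add: vzero_def)
next
  case (Suc N)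
  have "f (vadd (\<lambda>x. \<Sum>m<N. c m * u m x) (vsc (c N) (u N)))
      = vadd (f (\<lambda>x. \<Sum>m<N. c m * u m x)) (vsc (c N) (f (u N)))"
    using assms(1,2) Suc.prems subspace_lincomb[OF assms(2), of N u c]
    by (simp add: lin_on_def subspace_vsc)
  then show ?case using Suc by (simp add: vdefs)
qed

lemma lin_on_Vcar:
  assumes "lin_on (Vcar p) f" "v \<in> Vcar p"
  shows "f v = (\<lambda>x. \<Sum>m<p. v m * f (unit_vec m) x)"
  using lin_on_lincomb[OF assms(1) subspace_Vcar, of p unit_vec v] unit_vec_in_Vcar
    Vcar_lincomb[OF assms(2)] by metis

lemma \<rho>V_in_Vcar: "\<rho>V p lam i v \<in> Vcar p"
  by (auto simp: \<rho>V_def Vcar_def)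

lemma submodule_Int:
  "submodule p \<rho> C A \<Longrightarrow> submodule p \<rho> C B \<Longrightarrow> submodule p \<rho> C (A \<inter> B)"
  by (auto simp: submodule_def subspace_def)

section \<open>Butterfly argument: exchanging two pairs of submodules\<close>

definition vsums :: "('b \<Rightarrow> 'a::field) set \<Rightarrow> ('b \<Rightarrow> 'a) set \<Rightarrow> ('b \<Rightarrow> 'a) set" where
  "vsums A B = {vadd a b | a b. a \<in> A \<and> b \<in> B}"

lemma submodule_vsums:
  assumes A: "submodule p \<rho> C A" and B: "submodule p \<rho> C B"
    and C: "subspace C" and \<rho>: "\<And>i. i < p \<Longrightarrow> lin_on C (\<rho> i)"
  shows "submodule p \<rho> C (vsums A B)"
  unfolding submodule_def
proof (intro conjI allI impI ballI)
  have sA: "subspace A" "A \<subseteq> C" and sB: "subspace B" "B \<subseteq> C"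
    using A B by (auto simp: submodule_def)
  show "vsums A B \<subseteq> C"
    using sA sB C by (auto simp: vsums_def intro!: subspace_vadd)
  show "subspace (vsums A B)"
    unfolding subspace_def
  proof (intro conjI ballI allI)
    have "vzero = vadd vzero vzero" by (simp add: vdefs)
    then show "vzero \<in> vsums A B"
      using sA sB subspace_vzero unfolding vsums_def by blast
  next
    fix u v assume "u \<in> vsums A B" "v \<in> vsums A B"
    then obtain a b a' b' where *: "u = vadd a b" "v = vadd a' b'" "a \<in> A" "a' \<in> A" "b \<in> B" "b' \<in> B"
      by (auto simp: vsums_def)
    have "vadd u v = vadd (vadd a a') (vadd b b')"
      by (simp add: * vadd_def algebra_simps)
    then show "vadd u v \<in> vsums A B"
      using * sA sB subspace_vadd unfolding vsums_def by blast
  next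
    fix c v assume "v \<in> vsums A B"
    then obtain a b where *: "v = vadd a b" "a \<in> A" "b \<in> B"
      by (auto simp: vsums_def)
    have "vsc c v = vadd (vsc c a) (vsc c b)"
      by (simp add: * vadd_def vsc_def algebra_simps)
    then show "vsc c v \<in> vsums A B"
      using * sA sB subspace_vsc unfolding vsums_def by blast
  qed
  fix i v assume i: "i < p" and "v \<in> vsums A B"
  then obtain a b where *: "v = vadd a b" "a \<in> A" "b \<in> B"
    by (auto simp: vsums_def)
  have "\<rho> i v = vadd (\<rho> i a) (\<rho> i b)"
    using \<rho>[OF i] * sA sB by (auto simp: lin_on_def)
  moreover have "\<rho> i a \<in> A" "\<rho> i b \<in> B"
    using A B * i by (auto simp: submodule_def)
  ultimately show "\<rho> i v \<in> vsums A B"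
    unfolding vsums_def by blast
qed

lemma vsums_upper1: "subspace B \<Longrightarrow> A \<subseteq> vsums A B"
proof
  fix a assume "subspace B" "a \<in> A"
  moreover have "a = vadd a vzero" by (simp add: vdefs)
  ultimately show "a \<in> vsums A B" unfolding vsums_def using subspace_vzero by blast
qed

lemma vsums_upper2: "subspace A \<Longrightarrow> B \<subseteq> vsums A B"
proof
  fix a assume "subspace A" "a \<in> B"
  moreover have "a = vadd vzero a" by (simp add: vdefs)
  ultimately show "a \<in> vsums A B" unfolding vsums_def using subspace_vzero by blast
qed

text \<open>\<open>vsums N B\<close> lies between \<open>N\<close> and \<open>N'\<close> and
  contains \<open>B\<close>, so it is not \<open>N\<close>; simplicity leaves only
  \<open>N'\<close>.\<close>

lemma simple_sq_vsums_eq: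
  assumes "simple_sq p \<rho> C N N'" "submodule p \<rho> C B" "B \<subseteq> N'" "\<not> B \<subseteq> N"
    and "subspace C" "\<And>i. i < p \<Longrightarrow> lin_on C (\<rho> i)"
  shows "vsums N B = N'"
proof -
  have N: "submodule p \<rho> C N" "subspace N" "N \<subset> N'" "subspace N'" "subspace B"
    using assms by (auto simp: simple_sq_def submodule_def)
  have "submodule p \<rho> C (vsums N B)"
    using submodule_vsums[OF N(1) assms(2,5,6)] .
  moreover have "N \<subseteq> vsums N B" using vsums_upper1 N by auto
  moreover have "B \<subseteq> vsums N B" using vsums_upper2 N by auto
  moreover have "vsums N B \<subseteq> N'"
    using N assms(3) by (auto simp: vsums_def intro!: subspace_vadd)
  ultimately show ?thesis
    using assms(1,4) unfolding simple_sq_def by blast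
qed

text \<open>\<open>P\<close> says that the part of \<open>M'\<close> in \<open>N'\<close> leaves
  \<open>M\<close> while its part in \<open>N\<close> does not. The conclusion is the same relation
  with the two pairs exchanged. If \<open>N' \<inter> M\<close> left \<open>N\<close>, then
  \<open>N + (N' \<inter> M)\<close> would be \<open>N'\<close> by simplicity, and the modular law
  would push \<open>M' \<inter> N'\<close> into \<open>M\<close>.\<close>

lemma simple_sq_butterfly:
  assumes N: "simple_sq p \<rho> C N N'"
    and M: "submodule p \<rho> C M" "submodule p \<rho> C M'" "M \<subseteq> M'"
    and C: "subspace C" "\<And>i. i < p \<Longrightarrow> lin_on C (\<rho> i)"
    and P: "M' \<inter> N \<subseteq> M" "\<not> M' \<inter> N' \<subseteq> M"
  shows "N' \<inter> M \<subseteq> N" "\<not> N' \<inter> M' \<subseteq> N"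
proof -
  show "\<not> N' \<inter> M' \<subseteq> N" using P by blast
  show "N' \<inter> M \<subseteq> N"
  proof (rule ccontr)
    assume nle: "\<not> N' \<inter> M \<subseteq> N"
    have "submodule p \<rho> C (N' \<inter> M)"
      using N M by (intro submodule_Int) (auto simp: simple_sq_def)
    then have eq: "vsums N (N' \<inter> M) = N'"
      using simple_sq_vsums_eq[OF N _ _ nle C] by blast
    have "M' \<inter> N' \<subseteq> M"
    proof
      fix x assume x: "x \<in> M' \<inter> N'"
      then have "x \<in> vsums N (N' \<inter> M)" using eq by simp
      then obtain a b where ab: "x = vadd a b" "a \<in> N" "b \<in> N'" "b \<in> M"
        unfolding vsums_def by blast
      \<comment> \<open>The modular law: \<open>x\<close> and \<open>b\<close> both lie in
        \<open>M'\<close>, so the \<open>N\<close>-part \<open>a\<close> does too, and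
        \<open>M' \<inter> N \<subseteq> M\<close> applies.\<close>
      have "a = vdiff x b" by (simp add: ab vdefs)
      then have "a \<in> M'"
        using x ab M by (metis IntD1 submodule_def subspace_vdiff subsetD)
      then have "a \<in> M" using ab P by blast
      then show "x \<in> M"
        using ab M by (auto simp: submodule_def intro!: subspace_vadd)
    qed
    with P show False by blast
  qed
qed

text \<open>A homomorphism to \<open>M'/M\<close> is moved to \<open>N'/N\<close> by choosing the images of the basis
  vectors in \<open>M' \<inter> N'\<close>, which surjects onto both quotients with the same kernel.\<close>

lemma is_L_sq_butterfly:
  fixes \<rho> :: "nat \<Rightarrow> ('b \<Rightarrow> 'a::field) \<Rightarrow> ('b \<Rightarrow> 'a)"
  assumes L: "is_L_sq p lam \<rho> C M M'" and N: "simple_sq p \<rho> C N N'"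
    and C: "subspace C" "\<And>i. i < p \<Longrightarrow> lin_on C (\<rho> i)"
    and P: "M' \<inter> N \<subseteq> M" "\<not> M' \<inter> N' \<subseteq> M"
  shows "is_L_sq p lam \<rho> C N N'"
proof -
  have M: "simple_sq p \<rho> C M M'" using L by (simp add: is_L_sq_def)
  have sub: "submodule p \<rho> C M" "submodule p \<rho> C M'" "submodule p \<rho> C N" "submodule p \<rho> C N'"
    "M \<subseteq> M'" "N \<subseteq> N'"
    using M N unfolding simple_sq_def by blast+
  then have ss: "subspace M" "subspace M'" "subspace N" "subspace N'"
    "M \<subseteq> C" "M' \<subseteq> C" "N \<subseteq> C" "N' \<subseteq> C"
    unfolding submodule_def by blast+
  note Q = simple_sq_butterfly[OF N sub(1,2,5) C P]
  have I: "submodule p \<rho> C (M' \<inter> N')"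
    by (rule submodule_Int) fact+
  have eqM: "vsums M (M' \<inter> N') = M'"
    using simple_sq_vsums_eq[OF M I _ _ C] P by auto
  have eqN: "vsums N (M' \<inter> N') = N'"
    using simple_sq_vsums_eq[OF N I _ _ C] Q by auto
  obtain f where f: "lin_on (Vcar p) f" "f ` Vcar p \<subseteq> M'"
    "\<And>i v. i < p \<Longrightarrow> v \<in> Vcar p \<Longrightarrow> vdiff (f (\<rho>V p lam i v)) (\<rho> i (f v)) \<in> M"
    "\<And>m. m \<in> M' \<Longrightarrow> \<exists>v\<in>Vcar p. vdiff m (f v) \<in> M"
    using L unfolding is_L_sq_def by blast
  have "\<exists>u. u \<in> M' \<inter> N' \<and> vdiff u (f (unit_vec m)) \<in> M" if "m < p" for m
  proof -
    have "f (unit_vec m) \<in> vsums M (M' \<inter> N')"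
      using eqM f(2) unit_vec_in_Vcar[OF that] by blast
    then obtain a u where au: "f (unit_vec m) = vadd a u" "a \<in> M" "u \<in> M' \<inter> N'"
      by (auto simp: vsums_def)
    have "vdiff u (f (unit_vec m)) = vsc (-1) a" by (simp add: au vdefs)
    then show ?thesis using au ss by (auto intro!: exI[of _ u] subspace_vsc)
  qed
  then obtain u where u: "\<And>m. m < p \<Longrightarrow> u m \<in> M' \<inter> N'"
    "\<And>m. m < p \<Longrightarrow> vdiff (u m) (f (unit_vec m)) \<in> M"
    by metis
  define g where "g = (\<lambda>v :: nat \<Rightarrow> 'a. \<lambda>x. \<Sum>m<p. v m * u m x)"
  have g_lin: "lin_on (Vcar p) g"
    by (auto simp: lin_on_def g_def vdefs algebra_simps sum.distrib sum_distrib_left)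
  have g_in: "g v \<in> M' \<inter> N'" for v
    unfolding g_def using I u by (intro subspace_lincomb) (auto simp: submodule_def)
  have g_f: "vdiff (g v) (f v) \<in> M" if "v \<in> Vcar p" for v
  proof -
    have "vdiff (g v) (f v) = (\<lambda>x. \<Sum>m<p. v m * vdiff (u m) (f (unit_vec m)) x)"
      unfolding lin_on_Vcar[OF f(1) that] g_def
      by (simp add: vdefs algebra_simps sum_subtractf)
    then show ?thesis using subspace_lincomb[OF ss(1), of p "\<lambda>m. vdiff (u m) (f (unit_vec m))" v] u(2) by simp
  qed
  have "vdiff (g (\<rho>V p lam i v)) (\<rho> i (g v)) \<in> N" if i: "i < p" and v: "v \<in> Vcar p" for i v
  proof -
    have fv: "f v \<in> M'" using f(2) v by blast
    have lin: "\<rho> i (vdiff (g v) (f v)) = vdiff (\<rho> i (g v)) (\<rho> i (f v))"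
      using lin_on_vdiff[OF C(2)[OF i] C(1)] g_in[of v] fv ss by blast
    \<comment> \<open>The defect of \<open>g\<close> lies in \<open>M\<close> because
      \<open>g\<close> and \<open>f\<close> agree modulo \<open>M\<close>, and in \<open>N'\<close>
      because \<open>g\<close> takes its values there; \<open>N' \<inter> M \<subseteq> N\<close>
      then puts it into \<open>N\<close>.\<close>
    let ?a = "vdiff (g (\<rho>V p lam i v)) (f (\<rho>V p lam i v))"
    let ?b = "vdiff (f (\<rho>V p lam i v)) (\<rho> i (f v))"
    let ?c = "\<rho> i (vdiff (g v) (f v))"
    have "vdiff (g (\<rho>V p lam i v)) (\<rho> i (g v)) = vdiff (vadd ?a ?b) ?c"
      unfolding lin by (simp add: vdefs)
    moreover have "?a \<in> M" "?b \<in> M" using g_f[OF \<rho>V_in_Vcar] f(3)[OF i v] .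
    moreover have "?c \<in> M" using g_f[OF v] sub(1) i by (auto simp: submodule_def)
    ultimately have 1: "vdiff (g (\<rho>V p lam i v)) (\<rho> i (g v)) \<in> M"
      using ss by (simp add: subspace_vadd subspace_vdiff)
    have "vdiff (g (\<rho>V p lam i v)) (\<rho> i (g v)) \<in> N'"
      using g_in sub(4) i by (auto simp: submodule_def intro!: subspace_vdiff)
    with 1 show ?thesis using Q by blast
  qed
  moreover have "\<exists>v\<in>Vcar p. vdiff m (g v) \<in> N" if "m \<in> N'" for m
  proof -
    have "m \<in> vsums N (M' \<inter> N')" using that eqN by simp
    then obtain a b where ab: "m = vadd a b" "a \<in> N" "b \<in> M' \<inter> N'"
      unfolding vsums_def by blast
    obtain v where v: "v \<in> Vcar p" "vdiff b (f v) \<in> M"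
      using f(4) ab by blast
    have "vdiff b (g v) = vdiff (vdiff b (f v)) (vdiff (g v) (f v))"
      by (simp add: vdefs)
    then have "vdiff b (g v) \<in> M"
      using v g_f[OF v(1)] ss by (simp add: subspace_vdiff)
    moreover have "vdiff b (g v) \<in> N'"
      using ab g_in ss by (auto intro!: subspace_vdiff)
    ultimately have "vdiff b (g v) \<in> N" using Q by blast
    moreover have "vdiff m (g v) = vadd a (vdiff b (g v))"
      by (simp add: ab vdefs algebra_simps)
    ultimately show ?thesis using ab v ss by (auto intro!: bexI[of _ v] subspace_vadd)
  qed
  ultimately show ?thesis
    unfolding is_L_sq_def using N g_lin g_in by blast
qed

section \<open>Jordan-Hoelder matching of labelled factors\<close>

lemma comp_series_mono:
  assumes "comp_series p \<rho> C M r" "i \<le> j" "j \<le> r"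
  shows "M i \<subseteq> M j"
  using assms(2,3)
proof (induction rule: dec_induct)
  case (step k)
  then have "M k \<subset> M (Suc k)"
    using assms(1) by (auto simp: comp_series_def simple_sq_def)
  then show ?case using step by auto
qed simp

text \<open>The intersections \<open>M (Suc i) \<inter> N j\<close> run from the zero space to all
  of \<open>M (Suc i)\<close>; the required \<open>j\<close> is the last one before they first leave
  \<open>M i\<close>.\<close>

lemma comp_series_factor_match:
  assumes M: "comp_series p \<rho> C M r" and N: "comp_series p \<rho> C N s" and i: "i < r"
  shows "\<exists>j<s. M (Suc i) \<inter> N j \<subseteq> M i \<and> \<not> M (Suc i) \<inter> N (Suc j) \<subseteq> M i"
proof -
  let ?Q = "\<lambda>j. \<not> M (Suc i) \<inter> N j \<subseteq> M i"
  have Mi: "M i \<subset> M (Suc i)" "subspace (M i)" "M (Suc i) \<subseteq> C"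
    using M i by (auto simp: comp_series_def simple_sq_def submodule_def)
  have "?Q s" using Mi N by (auto simp: comp_series_def)
  moreover have "\<not> ?Q 0" using N subspace_vzero[OF Mi(2)] by (auto simp: comp_series_def)
  ultimately have "\<exists>j<s. (\<forall>i\<le>j. \<not> ?Q i) \<and> ?Q (Suc j)"
    using ex_least_nat_less[of ?Q s] by blast
  then show ?thesis by blast
qed

text \<open>Matched factors carry the same label by the butterfly transfer, so an injective matching
  bounds one count by the other. An inequality is enough, since the two series can be
  exchanged.\<close>

lemma comp_series_card_le:
  assumes M: "comp_series p \<rho> C M r" and N: "comp_series p \<rho> C N s"
    and C: "subspace C" "\<And>i. i < p \<Longrightarrow> lin_on C (\<rho> i)"
  shows "card {i. i < r \<and> is_L_sq p lam \<rho> C (M i) (M (Suc i))}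
       \<le> card {j. j < s \<and> is_L_sq p lam \<rho> C (N j) (N (Suc j))}"
proof -
  let ?P = "\<lambda>i j. M (Suc i) \<inter> N j \<subseteq> M i \<and> \<not> M (Suc i) \<inter> N (Suc j) \<subseteq> M i"
  obtain \<phi> where \<phi>: "\<And>i. i < r \<Longrightarrow> \<phi> i < s" "\<And>i. i < r \<Longrightarrow> ?P i (\<phi> i)"
    using comp_series_factor_match[OF M N] by metis
  have sM: "simple_sq p \<rho> C (M i) (M (Suc i))" if "i < r" for i
    using M that by (auto simp: comp_series_def)
  have sN: "simple_sq p \<rho> C (N i) (N (Suc i))" if "i < s" for i
    using N that by (auto simp: comp_series_def)
  have sym: "N (Suc j) \<inter> M i \<subseteq> N j" "\<not> N (Suc j) \<inter> M (Suc i) \<subseteq> N j"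
    if "i < r" "j < s" "?P i j" for i j
    using simple_sq_butterfly[OF sN[OF that(2)] _ _ _ C, of "M i" "M (Suc i)"] that(3) sM[OF that(1)]
    by (auto simp: simple_sq_def)
  \<comment> \<open>If \<open>i\<close> and \<open>i'\<close> were matched with the same
    \<open>j\<close>, the exchanged relation for \<open>i'\<close> would keep
    \<open>N (Suc j) \<inter> M i'\<close> inside \<open>N j\<close>, yet by the one for
    \<open>i\<close> the part in \<open>M (Suc i) \<subseteq> M i'\<close> already leaves
    \<open>N j\<close>.\<close>
  have less: False if "i < i'" "i' < r" "\<phi> i = \<phi> i'" for i i'
  proof -
    let ?j = "\<phi> i"
    have "i < r" using that by simp
    have "N (Suc ?j) \<inter> M i' \<subseteq> N ?j"
      using sym(1)[of i' "\<phi> i'"] \<phi>[of i'] that by simp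
    moreover have "M (Suc i) \<subseteq> M i'"
      using comp_series_mono[OF M] that by simp
    moreover have "\<not> N (Suc ?j) \<inter> M (Suc i) \<subseteq> N ?j"
      using sym(2)[of i ?j] \<phi>[of i] \<open>i < r\<close> by simp
    ultimately show False by blast
  qed
  show ?thesis
  proof (rule card_inj_on_le[of \<phi>])
    show "inj_on \<phi> {i. i < r \<and> is_L_sq p lam \<rho> C (M i) (M (Suc i))}"
    proof (rule inj_onI)
      fix i i' assume "i \<in> {i. i < r \<and> is_L_sq p lam \<rho> C (M i) (M (Suc i))}"
        "i' \<in> {i. i < r \<and> is_L_sq p lam \<rho> C (M i) (M (Suc i))}" "\<phi> i = \<phi> i'"
      then show "i = i'" using less[of i i'] less[of i' i] by (cases i i' rule: linorder_cases) auto
    qed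
    show "\<phi> ` {i. i < r \<and> is_L_sq p lam \<rho> C (M i) (M (Suc i))}
        \<subseteq> {j. j < s \<and> is_L_sq p lam \<rho> C (N j) (N (Suc j))}"
      using \<phi> is_L_sq_butterfly[OF _ sN C] by blast
  qed simp
qed

lemma comp_series_card_eq:
  assumes "comp_series p \<rho> C M r" "comp_series p \<rho> C N s"
    and "subspace C" "\<And>i. i < p \<Longrightarrow> lin_on C (\<rho> i)"
  shows "card {i. i < r \<and> is_L_sq p lam \<rho> C (M i) (M (Suc i))}
       = card {j. j < s \<and> is_L_sq p lam \<rho> C (N j) (N (Suc j))}"
  using comp_series_card_le[OF assms(1,2,3,4)] comp_series_card_le[OF assms(2,1,3,4)]
  by (rule order_antisym)

text \<open>The vector is the image of \<open>v_0\<close>. It cannot lie in \<open>N\<close>, since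
  otherwise every \<open>v_j = \<partial>^j v_0\<close> would be sent into \<open>N\<close> and the
  map would not be onto \<open>M/N\<close>. This turns the label into a weight that can be computed,
  which later excludes all wrong labels.\<close>

lemma is_L_sq_singular_vector:
  fixes \<rho> :: "nat \<Rightarrow> ('b \<Rightarrow> 'a::field) \<Rightarrow> ('b \<Rightarrow> 'a)"
  assumes "is_L_sq p lam \<rho> C N M" "1 < p"
  obtains m where "m \<in> M" "m \<notin> N" "\<forall>k. 2 \<le> k \<longrightarrow> k < p \<longrightarrow> \<rho> k m \<in> N"
    "vdiff (\<rho> 1 m) (vsc (of_nat lam) m) \<in> N"
proof -
  have p0: "0 < p" using assms(2) by simp
  have S: "submodule p \<rho> C N" "subspace N" "subspace M" "N \<subset> M"
    using assms(1) by (auto simp: is_L_sq_def simple_sq_def submodule_def)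
  obtain f where f: "lin_on (Vcar p) f" "f ` Vcar p \<subseteq> M"
    "\<And>i v. i < p \<Longrightarrow> v \<in> Vcar p \<Longrightarrow> vdiff (f (\<rho>V p lam i v)) (\<rho> i (f v)) \<in> N"
    "\<And>m. m \<in> M \<Longrightarrow> \<exists>v\<in>Vcar p. vdiff m (f v) \<in> N"
    using assms(1) unfolding is_L_sq_def by blast
  let ?m = "f (unit_vec 0)"
  have step: "\<rho>V p lam 0 (unit_vec j) = (unit_vec (Suc j) :: nat \<Rightarrow> 'a)" if "Suc j < p" for j
    using that by (auto simp: \<rho>V_def unit_vec_def cV_def fun_eq_iff)
  have "?m \<notin> N"
  proof
    assume m: "?m \<in> N"
    have all: "f (unit_vec j) \<in> N" if "j < p" for j
      using that
    proof (induction j)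
      case (Suc j)
      have "vdiff (f (unit_vec (Suc j))) (\<rho> 0 (f (unit_vec j))) \<in> N" (is "?d \<in> N")
        using f(3)[of 0 "unit_vec j"] step[of j] Suc.prems unit_vec_in_Vcar[of j p] by simp
      moreover have "\<rho> 0 (f (unit_vec j)) \<in> N" (is "?e \<in> N")
        using Suc S(1) p0 by (auto simp: submodule_def)
      ultimately have "vadd ?d ?e \<in> N" using S by (simp add: subspace_vadd)
      then show ?case by (simp add: vdefs)
    qed (use m in simp)
    have fN: "f v \<in> N" if "v \<in> Vcar p" for v
      unfolding lin_on_Vcar[OF f(1) that] using S(2) all by (intro subspace_lincomb) auto
    have "M \<subseteq> N"
    proof
      fix x assume "x \<in> M"
      then obtain v where v: "v \<in> Vcar p" "vdiff x (f v) \<in> N" using f(4) by blast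
      then have "vadd (vdiff x (f v)) (f v) \<in> N" using fN S by (simp add: subspace_vadd)
      then show "x \<in> N" by (simp add: vdefs)
    qed
    with S show False by blast
  qed
  moreover have "\<rho> k ?m \<in> N" if "2 \<le> k" "k < p" for k
  proof -
    have "\<rho>V p lam k (unit_vec 0) = (vzero :: nat \<Rightarrow> 'a)"
      using that by (auto simp: \<rho>V_def unit_vec_def vzero_def fun_eq_iff)
    then have "vdiff vzero (\<rho> k ?m) \<in> N"
      using f(3)[OF that(2) unit_vec_in_Vcar[OF p0]] lin_on_vzero[OF f(1) subspace_Vcar] by simp
    then have "vsc (-1) (vdiff vzero (\<rho> k ?m)) \<in> N" using S by (simp add: subspace_vsc)
    then show ?thesis by (simp add: vdefs)
  qed
  moreover have "vdiff (\<rho> 1 ?m) (vsc (of_nat lam) ?m) \<in> N"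
  proof -
    have "\<rho>V p lam 1 (unit_vec 0) = vsc (of_nat lam) (unit_vec 0 :: nat \<Rightarrow> 'a)"
      using assms(2) by (auto simp: \<rho>V_def unit_vec_def vsc_def fun_eq_iff cV_def)
    moreover have "f (vsc (of_nat lam) (unit_vec 0)) = vsc (of_nat lam) ?m"
      using f(1) p0 by (simp add: lin_on_def unit_vec_in_Vcar)
    ultimately have "vdiff (vsc (of_nat lam) ?m) (\<rho> 1 ?m) \<in> N"
      using f(3)[OF assms(2) unit_vec_in_Vcar[OF p0]] by simp
    then have "vsc (-1) (vdiff (vsc (of_nat lam) ?m) (\<rho> 1 ?m)) \<in> N" using S by (simp add: subspace_vsc)
    then show ?thesis by (simp add: vdefs)
  qed
  moreover have "?m \<in> M" using f(2) unit_vec_in_Vcar[OF p0] by blast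
  ultimately show ?thesis using that by blast
qed

section \<open>Coordinates on W(n)\<close>

text \<open>Exponent vectors are 0 outside the variables, whereas \<open>PiE\<close> prescribes
  \<open>undefined\<close> there; exchanging the two default values is the bijection that gives the
  count.\<close>

lemma card_bounded_funs:
  fixes A :: "'i set" and p :: nat
  assumes "finite A"
  shows "finite {\<beta>. (\<forall>i\<in>A. \<beta> i < p) \<and> (\<forall>i. i \<notin> A \<longrightarrow> \<beta> i = 0)}"
    and "card {\<beta>. (\<forall>i\<in>A. \<beta> i < p) \<and> (\<forall>i. i \<notin> A \<longrightarrow> \<beta> i = 0)} = p ^ card A"
proof -
  let ?B = "{\<beta>. (\<forall>i\<in>A. \<beta> i < p) \<and> (\<forall>i. i \<notin> A \<longrightarrow> \<beta> i = 0)}"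
  have bij: "bij_betw (\<lambda>g i. if i \<in> A then g i else 0) (A \<rightarrow>\<^sub>E {..<p}) ?B"
    by (rule bij_betw_byWitness[where f' = "\<lambda>\<beta>. restrict \<beta> A"])
      (auto simp: fun_eq_iff PiE_def extensional_def)
  then show "finite ?B"
    using bij_betw_finite[OF bij] assms by (simp add: finite_PiE)
  have "card (A \<rightarrow>\<^sub>E {..<p}) = p ^ card A"
    using assms by (simp add: card_PiE)
  then show "card ?B = p ^ card A"
    using bij_betw_same_card[OF bij] by simp
qed

lemma Mon_eq: "Mon p n = {\<beta>. (\<forall>i\<in>{..<n}. \<beta> i < p) \<and> (\<forall>i. i \<notin> {..<n} \<longrightarrow> \<beta> i = 0)}"
  by (auto simp: Mon_def)

lemma finite_Mon: "finite (Mon p n)"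
  unfolding Mon_eq by (rule card_bounded_funs) simp

text \<open>The exponents of the variables other than \<open>x_1\<close>, stored with a 0 in place
  0. A block is named by such a \<open>\<beta>\<close>, and \<open>\<beta>(0 := c)\<close> restores
  the exponent of \<open>x_1\<close>.\<close>

definition Mon0 :: "nat \<Rightarrow> nat \<Rightarrow> (nat \<Rightarrow> nat) set" where
  "Mon0 p n = {\<beta> \<in> Mon p n. \<beta> 0 = 0}"

lemma Mon0_eq:
  assumes "0 < p"
  shows "Mon0 p n = {\<beta>. (\<forall>i\<in>{1..<n}. \<beta> i < p) \<and> (\<forall>i. i \<notin> {1..<n} \<longrightarrow> \<beta> i = 0)}"
proof (intro set_eqI)
  fix \<beta> :: "nat \<Rightarrow> nat"
  show "\<beta> \<in> Mon0 p n \<longleftrightarrow> \<beta> \<in> {\<beta>. (\<forall>i\<in>{1..<n}. \<beta> i < p) \<and> (\<forall>i. i \<notin> {1..<n} \<longrightarrow> \<beta> i = 0)}"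
    using assms unfolding Mon0_def Mon_def
    by (auto simp: not_less) (metis Suc_leI neq0_conv)+
qed

lemma finite_Mon0: "finite (Mon0 p n)"
  by (simp add: Mon0_def finite_Mon)

lemma card_Mon0: "0 < p \<Longrightarrow> card (Mon0 p n) = p ^ (n - 1)"
  using card_bounded_funs(2)[of "{1..<n}" p] by (simp add: Mon0_eq)

lemma Mon_upd0: "\<gamma> \<in> Mon p n \<Longrightarrow> c < p \<Longrightarrow> 0 < n \<Longrightarrow> \<gamma>(0 := c) \<in> Mon p n"
  by (auto simp: Mon_def)

lemma Mon_lt: "\<gamma> \<in> Mon p n \<Longrightarrow> 0 < n \<Longrightarrow> \<gamma> 0 < p"
  by (auto simp: Mon_def)

lemma Mon_upd0_iff: "\<gamma> \<in> Mon p n \<Longrightarrow> 0 < n \<Longrightarrow> \<gamma>(0 := c) \<in> Mon p n \<longleftrightarrow> c < p"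
  using Mon_lt[of "\<gamma>(0 := c)" p n] by (auto simp: Mon_upd0)

definition x0pow :: "nat \<Rightarrow> nat \<Rightarrow> nat" where
  "x0pow k = (\<lambda>i. if i = 0 then k else 0)"

lemma x0pow_in_Mon: "k < p \<Longrightarrow> 0 < n \<Longrightarrow> x0pow k \<in> Mon p n"
  by (auto simp: Mon_def x0pow_def)

lemma Amul_commute: "Amul p n f g = Amul p n g f"
proof
  fix \<gamma>
  have "(\<Sum>\<alpha>\<in>Mon p n. \<Sum>\<beta>\<in>Mon p n. if (\<lambda>i. \<alpha> i + \<beta> i) = \<gamma> then f \<alpha> * g \<beta> else 0)
      = (\<Sum>\<beta>\<in>Mon p n. \<Sum>\<alpha>\<in>Mon p n. if (\<lambda>i. \<beta> i + \<alpha> i) = \<gamma> then g \<beta> * f \<alpha> else 0)"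
    by (subst sum.swap) (auto intro!: sum.cong simp: add.commute mult.commute)
  then show "Amul p n f g \<gamma> = Amul p n g f \<gamma>"
    by (simp add: Amul_def)
qed

lemma Amul_zero: "Amul p n (\<lambda>_. 0) g = (\<lambda>_. 0)" "Amul p n g (\<lambda>_. 0) = (\<lambda>_. 0)"
  by (auto simp: Amul_def fun_eq_iff cong: if_cong)

lemma Amul_x0pow:
  assumes "k < p" "0 < n"
  shows "Amul p n (\<lambda>\<beta>. if \<beta> = x0pow k then c else 0) g \<gamma>
       = (if \<gamma> \<in> Mon p n \<and> k \<le> \<gamma> 0 then c * g (\<gamma>(0 := \<gamma> 0 - k)) else 0)"
proof (cases "\<gamma> \<in> Mon p n")
  case True
  have shift: "(\<lambda>i. x0pow k i + \<beta> i) = \<gamma> \<longleftrightarrow> k \<le> \<gamma> 0 \<and> \<beta> = \<gamma>(0 := \<gamma> 0 - k)" for \<beta>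
    by (auto simp: x0pow_def fun_eq_iff)
  have "Amul p n (\<lambda>\<beta>. if \<beta> = x0pow k then c else 0) g \<gamma>
      = (\<Sum>\<alpha>\<in>Mon p n. if \<alpha> = x0pow k then
           (\<Sum>\<beta>\<in>Mon p n. if (\<lambda>i. x0pow k i + \<beta> i) = \<gamma> then c * g \<beta> else 0) else 0)"
    using True unfolding Amul_def by (auto intro!: sum.cong sum.neutral)
  also have "\<dots> = (\<Sum>\<beta>\<in>Mon p n. if (\<lambda>i. x0pow k i + \<beta> i) = \<gamma> then c * g \<beta> else 0)"
    using finite_Mon x0pow_in_Mon[OF assms] by (simp add: sum.delta)
  also have "\<dots> = (\<Sum>\<beta>\<in>Mon p n. if \<beta> = \<gamma>(0 := \<gamma> 0 - k) then (if k \<le> \<gamma> 0 then c * g \<beta> else 0) else 0)"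
    unfolding shift by (intro sum.cong) auto
  also have "\<dots> = (if k \<le> \<gamma> 0 then c * g (\<gamma>(0 := \<gamma> 0 - k)) else 0)"
  proof -
    have "\<gamma> 0 - k < p" using Mon_lt[OF True assms(2)] by simp
    then have "\<gamma>(0 := \<gamma> 0 - k) \<in> Mon p n"
      using True assms by (intro Mon_upd0)
    then show ?thesis
      using finite_Mon by (simp add: sum.delta)
  qed
  finally show ?thesis using True by simp
qed (simp add: Amul_def)

lemma Apd_Wth:
  assumes "k < p" "0 < n"
  shows "Apd p n i (\<lambda>\<beta>. Wth p n k (j, \<beta>) :: 'a::field)
    = (if i = 0 \<and> j = 0 then (\<lambda>\<beta>. if \<beta> = x0pow (k - 1) then of_nat k else 0) else (\<lambda>_. 0))"
proof (cases "i = 0 \<and> j = 0")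
  case True
  have "Apd p n 0 (\<lambda>\<beta>. Wth p n k (0, \<beta>) :: 'a) \<gamma> = (if \<gamma> = x0pow (k - 1) then of_nat k else 0)" for \<gamma>
  proof (cases "k = 0")
    \<comment> \<open>Here \<open>k - 1\<close> truncates to 0, which is harmless because the
      coefficient \<open>of_nat k\<close> is 0.\<close>
    case True
    then have "\<gamma>(0 := Suc (\<gamma> 0)) \<noteq> (\<lambda>i. if i = 0 then k else 0)"
      by (auto simp: fun_eq_iff)
    then have "Apd p n 0 (\<lambda>\<beta>. Wth p n k (0, \<beta>) :: 'a) \<gamma> = 0" by (simp add: Apd_def Wth_def)
    then show ?thesis using True by simp
  next
    case False
    then have "\<gamma>(0 := Suc (\<gamma> 0)) = (\<lambda>i. if i = 0 then k else 0) \<longleftrightarrow> \<gamma> = x0pow (k - 1)"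
      by (auto simp: fun_eq_iff x0pow_def)
    moreover have "\<gamma> \<in> Mon p n" "\<gamma>(0 := Suc (\<gamma> 0)) \<in> Mon p n" "Suc (\<gamma> 0) = k" if "\<gamma> = x0pow (k - 1)"
      using that False assms by (auto simp: Mon_def x0pow_def)
    ultimately show ?thesis by (auto simp: Apd_def Wth_def)
  qed
  then show ?thesis using True by auto
next
  case False
  have "\<gamma>(i := Suc (\<gamma> i)) \<noteq> (\<lambda>i. if i = 0 then k else 0)" if "i \<noteq> 0" for \<gamma>
    using that by (auto simp: fun_eq_iff)
  then show ?thesis using False by (auto simp: Apd_def Wth_def fun_eq_iff)
qed

text \<open>The bracket is read backwards: the coefficient at \<open>\<gamma>\<close> comes from the
  single monomial with \<open>x_1\<close>-exponent \<open>a = Suc (\<gamma> 0) - k\<close>, with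
  factor \<open>a\<close> from differentiating that monomial and, for \<open>j = 0\<close>,
  \<open>- k\<close> from differentiating \<open>x_1^k\<close>. The bounds keep \<open>a\<close> in
  the range of exponents; for \<open>\<gamma>\<close> in \<open>Mon p n\<close> the upper one fails
  only if \<open>k = 0\<close> and \<open>\<gamma> 0 = p - 1\<close>.\<close>

lemma \<rho>W_coord:
  fixes D :: "nat \<times> (nat \<Rightarrow> nat) \<Rightarrow> 'a::field"
  assumes "k < p" "0 < n" "D \<in> Wcar p n"
  shows "\<rho>W p n k D (j, \<gamma>) =
    (if j < n \<and> \<gamma> \<in> Mon p n \<and> k \<le> Suc (\<gamma> 0) \<and> Suc (\<gamma> 0) - k < p
     then (of_nat (Suc (\<gamma> 0) - k) - (if j = 0 then of_nat k else 0)) * D (j, \<gamma>(0 := Suc (\<gamma> 0) - k))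
     else 0)"
proof -
  let ?E = "\<lambda>j \<beta>. D (j, \<beta>)"
  have W: "(\<lambda>\<beta>. Wth p n k (i, \<beta>) :: 'a) = (if i = 0 then (\<lambda>\<beta>. if \<beta> = x0pow k then 1 else 0) else (\<lambda>_. 0))" for i
    by (auto simp: Wth_def x0pow_def fun_eq_iff)
  have "\<rho>W p n k D (j, \<gamma>) = (\<Sum>i<n. if i = 0 then
      Amul p n (\<lambda>\<beta>. if \<beta> = x0pow k then 1 else 0) (Apd p n 0 (?E j)) \<gamma>
    - (if j = 0 then Amul p n (?E 0) (\<lambda>\<beta>. if \<beta> = x0pow (k - 1) then of_nat k else 0) \<gamma> else 0) else 0)"
    unfolding \<rho>W_def Wbr_def prod.case
    by (intro sum.cong refl, subst Apd_Wth[OF assms(1,2)], subst W) (simp add: Amul_zero)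
  also have "\<dots> = Amul p n (\<lambda>\<beta>. if \<beta> = x0pow k then 1 else 0) (Apd p n 0 (?E j)) \<gamma>
    - (if j = 0 then Amul p n (\<lambda>\<beta>. if \<beta> = x0pow (k - 1) then of_nat k else 0) (?E 0) \<gamma> else 0)"
    using assms(2) by (simp add: sum.delta Amul_commute[of p n "?E 0"])
  also have "\<dots> = (if \<gamma> \<in> Mon p n \<and> k \<le> \<gamma> 0 then Apd p n 0 (?E j) (\<gamma>(0 := \<gamma> 0 - k)) else 0)
    - (if j = 0 \<and> \<gamma> \<in> Mon p n \<and> k - 1 \<le> \<gamma> 0 then of_nat k * ?E 0 (\<gamma>(0 := \<gamma> 0 - (k - 1))) else 0)"
    using assms by (simp add: Amul_x0pow)
  also have "\<dots> = (if j < n \<and> \<gamma> \<in> Mon p n \<and> k \<le> Suc (\<gamma> 0) \<and> Suc (\<gamma> 0) - k < p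
     then (of_nat (Suc (\<gamma> 0) - k) - (if j = 0 then of_nat k else 0)) * D (j, \<gamma>(0 := Suc (\<gamma> 0) - k))
     else 0)"
  proof (cases "j < n \<and> \<gamma> \<in> Mon p n")
    case False
    then show ?thesis using assms by (auto simp: Wcar_def Apd_def)
  next
    case jg: True
    have lt: "\<gamma> 0 < p" using jg assms by (auto simp: Mon_lt)
    have 1: "(if k \<le> \<gamma> 0 then Apd p n 0 (?E j) (\<gamma>(0 := \<gamma> 0 - k)) else 0)
      = (if k \<le> Suc (\<gamma> 0) \<and> Suc (\<gamma> 0) - k < p
         then of_nat (Suc (\<gamma> 0) - k) * D (j, \<gamma>(0 := Suc (\<gamma> 0) - k)) else 0)"
    proof (cases "k \<le> \<gamma> 0")
      case True
      have "\<gamma>(0 := \<gamma> 0 - k) \<in> Mon p n" using jg lt assms by (intro Mon_upd0) auto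
      then show ?thesis using True jg assms
        by (auto simp: Apd_def Suc_diff_le Mon_upd0_iff simp del: of_nat_Suc)
    next
      \<comment> \<open>If \<open>k = Suc (\<gamma> 0)\<close>, the source exponent is 0 and so is
        its factor: constants have derivative 0.\<close>
      case False
      then show ?thesis by auto
    qed
    have 2: "(if k - 1 \<le> \<gamma> 0 then of_nat k * ?E 0 (\<gamma>(0 := \<gamma> 0 - (k - 1))) else 0)
      = (if k \<le> Suc (\<gamma> 0) \<and> Suc (\<gamma> 0) - k < p
         then of_nat k * D (0, \<gamma>(0 := Suc (\<gamma> 0) - k)) else 0)"
    proof (cases k)
      case (Suc k')
      then show ?thesis using lt by auto
    qed simp
    show ?thesis using jg 1 2 by (auto simp: algebra_simps)
  qed
  finally show ?thesis .
qed

section \<open>One-variable blocks\<close>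

text \<open>\<open>\<partial>\<^sup>m x\<^sup>p\<^sup>-\<^sup>1 = wcoef m x\<^sup>p\<^sup>-\<^sup>1\<^sup>-\<^sup>m\<close>, since \<open>p - i = -i\<close> in characteristic \<open>p\<close>.\<close>

definition wcoef :: "nat \<Rightarrow> 'a::field" where
  "wcoef m = (-1) ^ m * of_nat (fact m)"

text \<open>The intertwining condition for \<open>verma_map\<close>, stripped of signs and lifted to
  the natural numbers; \<open>1 + s\<close> is minus the highest weight modulo \<open>p\<close>.
  With \<open>b = m + k - 1\<close>, clearing factorials gives
  \<open>m! k! (b choose k) = m b!\<close> and
  \<open>m! k! (b choose (k - 1)) = k b!\<close>.\<close>

lemma wcoef_nat_identity:
  fixes k m s :: nat
  assumes "0 < k"
  shows "fact m * fact k * (((m + k - 1) choose k) + (1 + s) * ((m + k - 1) choose (k - 1)))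
       = (m + k + s * k) * fact (m + k - 1)"
proof -
  obtain k' where k: "k = Suc k'" using assms by (cases k) auto
  have A: "fact k' * fact m * ((m + k') choose k') = (fact (m + k') :: nat)"
    using binomial_fact_lemma[of k' "m + k'"] by simp
  have B: "fact m * fact (Suc k') * ((m + k') choose (Suc k')) = m * fact (m + k')"
  proof (cases m)
    case (Suc m')
    have "fact (Suc k') * fact m' * ((m' + Suc k') choose (Suc k')) = (fact (m' + Suc k') :: nat)"
      using binomial_fact_lemma[of "Suc k'" "m' + Suc k'"] by simp
    then have "Suc m' * (fact (Suc k') * fact m' * ((m' + Suc k') choose (Suc k')))
        = Suc m' * (fact (m' + Suc k') :: nat)" by simp
    then show ?thesis unfolding Suc by (simp add: algebra_simps)
  qed simp
  have "fact m * fact k * (((m + k - 1) choose k) + (1 + s) * ((m + k - 1) choose (k - 1)))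
      = fact m * fact (Suc k') * ((m + k') choose (Suc k'))
        + (1 + s) * Suc k' * (fact k' * fact m * ((m + k') choose k'))"
    unfolding k by (simp add: algebra_simps)
  also have "\<dots> = (m + k + s * k) * fact (m + k - 1)"
    unfolding A B k by (simp add: algebra_simps)
  finally show ?thesis .
qed

text \<open>The action \<open>x\<^sup>a \<mapsto> (a - s k) x\<^sup>a\<^sup>+\<^sup>k\<^sup>-\<^sup>1\<close> of \<open>x\<^sup>k \<partial>\<close>: for \<open>s = 0\<close> this is \<open>A(1)\<close>,
  for \<open>s = 1\<close> the adjoint module of \<open>W(1)\<close>.\<close>

definition act :: "nat \<Rightarrow> nat \<Rightarrow> nat \<Rightarrow> (nat \<Rightarrow> 'a::field) \<Rightarrow> nat \<Rightarrow> 'a" where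
  "act p s k v = (\<lambda>c. if c < p \<and> k \<le> Suc c \<and> Suc c - k < p
     then (of_nat (Suc c - k) - of_nat (s * k)) * v (Suc c - k) else 0)"

lemma act_in_Vcar: "act p s k v \<in> Vcar p"
  by (auto simp: act_def Vcar_def)

text \<open>The homomorphism determined by sending \<open>v_0\<close> to \<open>x^(p-1)\<close>: it
  sends \<open>v_m = \<partial>^m v_0\<close> to \<open>\<partial>^m x^(p-1)\<close>, so index
  \<open>c\<close> of the output belongs to \<open>m = p - 1 - c\<close>.\<close>

definition verma_map :: "nat \<Rightarrow> (nat \<Rightarrow> 'a::field) \<Rightarrow> nat \<Rightarrow> 'a" where
  "verma_map p v = (\<lambda>c. if c < p then wcoef (p - 1 - c) * v (p - 1 - c) else 0)"

section \<open>Arithmetic modulo p, Verma modules as blocks, and simple layers of a block\<close>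

locale witt_setting =
  fixes p n :: nat and ty :: "'a::field itself"
  assumes prime_p: "prime p" and p_gt_2: "p > 2" and char_p: "CHAR('a) = p" and n_pos: "0 < n"
begin

lemma of_nat_eq_0_iff_p: "(of_nat k :: 'a) = 0 \<longleftrightarrow> p dvd k"
  using of_nat_eq_0_iff_char_dvd[where 'a = 'a] char_p by simp

lemma of_nat_neq_0: "0 < k \<Longrightarrow> k < p \<Longrightarrow> (of_nat k :: 'a) \<noteq> 0"
  by (auto simp: of_nat_eq_0_iff_p dest: dvd_imp_le)

lemma of_nat_eq_iff_lt: "k < p \<Longrightarrow> l < p \<Longrightarrow> (of_nat k :: 'a) = of_nat l \<longleftrightarrow> k = l"
proof (induction k l rule: linorder_wlog)
  case (le k l)
  have "(of_nat k :: 'a) = of_nat l \<longleftrightarrow> (of_nat (l - k) :: 'a) = 0"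
    using le by (auto simp: of_nat_diff)
  also have "\<dots> \<longleftrightarrow> k = l"
    using le of_nat_neq_0[of "l - k"] by (cases "k = l") auto
  finally show ?case .
qed auto

lemma of_nat_p_diff: "m \<le> p \<Longrightarrow> (of_nat (p - m) :: 'a) = - of_nat m"
  using of_nat_eq_0_iff_p[of p] by (simp add: of_nat_diff)

lemma wcoef_neq_0: "m < p \<Longrightarrow> (wcoef m :: 'a) \<noteq> 0"
  using prime_p by (simp add: wcoef_def of_nat_eq_0_iff_p prime_dvd_fact_iff del: of_nat_fact)

text \<open>Each \<open>v_m\<close> goes to a multiple of \<open>x^(p-1-m)\<close>, and the
  multiplier is nonzero because \<open>p\<close> does not divide \<open>m!\<close> for
  \<open>m < p\<close>. So a block is a whole Verma module and not just a quotient of one.\<close>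

lemma bij_verma_map: "bij_betw (verma_map p) (Vcar p) (Vcar p :: (nat \<Rightarrow> 'a) set)"
proof (rule bij_betw_byWitness[where f' = "\<lambda>u c. if c < p then u (p - 1 - c) / wcoef c else 0"])
  show "\<forall>v\<in>Vcar p. (\<lambda>c. if c < p then verma_map p v (p - 1 - c) / wcoef c else 0) = (v :: nat \<Rightarrow> 'a)"
    using wcoef_neq_0 by (auto simp: verma_map_def Vcar_def fun_eq_iff)
  show "\<forall>u\<in>Vcar p. verma_map p (\<lambda>c. if c < p then u (p - 1 - c) / wcoef c else 0) = (u :: nat \<Rightarrow> 'a)"
    using wcoef_neq_0 by (auto simp: verma_map_def Vcar_def fun_eq_iff)
qed (auto simp: verma_map_def Vcar_def)

text \<open>Modulo \<open>p\<close> the highest weight \<open>p - 1 - s\<close> is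
  \<open>-(1 + s)\<close> and the exponent \<open>p - (m + k)\<close> is \<open>-(m + k)\<close>;
  for \<open>k > 0\<close> the claim is then \<open>wcoef_nat_identity\<close> up to a common sign.
  For \<open>k = 0\<close> it is the recursion \<open>wcoef m = - m * wcoef (m - 1)\<close>.\<close>

lemma cV_wcoef:
  assumes "s \<le> 1" "1 \<le> m + k" "m + k \<le> p"
  shows "wcoef m * cV (p - 1 - s) k (m + k - 1)
       = (of_nat (p - (m + k)) - of_nat (s * k)) * (wcoef (m + k - 1) :: 'a)"
proof (cases "k = 0")
  case True
  then obtain m' where "m = Suc m'" using assms by (cases m) auto
  then show ?thesis
    using True assms of_nat_p_diff[of m] by (simp add: cV_def wcoef_def algebra_simps)
next
  case False
  have lam: "(of_nat (p - 1 - s) :: 'a) = - of_nat (1 + s)"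
    using of_nat_p_diff[of "1 + s"] assms p_gt_2 by simp
  let ?N = "fact m * fact k * (((m + k - 1) choose k) + (1 + s) * ((m + k - 1) choose (k - 1)))"
  have "wcoef m * cV (p - 1 - s) k (m + k - 1) = (-1) ^ (m + k) * (of_nat ?N :: 'a)"
    using False unfolding wcoef_def cV_def lam by (simp add: power_add algebra_simps del: of_nat_fact)
  also have "\<dots> = (-1) ^ (m + k) * (of_nat ((m + k + s * k) * fact (m + k - 1)) :: 'a)"
    using wcoef_nat_identity[of k m s] False by simp
  also have "(-1) ^ (m + k) = - ((-1) ^ (m + k - 1) :: 'a)"
    using False by (cases k) auto
  also have "- ((-1) ^ (m + k - 1)) * (of_nat ((m + k + s * k) * fact (m + k - 1)) :: 'a)
      = (of_nat (p - (m + k)) - of_nat (s * k)) * wcoef (m + k - 1)"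
    using assms of_nat_p_diff[of "m + k"] by (simp add: wcoef_def algebra_simps)
  finally show ?thesis .
qed

text \<open>The weight \<open>p - 1 - s\<close> is the eigenvalue of \<open>x \<partial>\<close> on
  \<open>x^(p-1)\<close>. The parameter \<open>s\<close> lets one computation serve the function
  blocks and the adjoint blocks.\<close>

lemma verma_map_hom:
  assumes "s \<le> 1" "k < p"
  shows "verma_map p (\<rho>V p (p - 1 - s) k v) = act p s k (verma_map p v :: nat \<Rightarrow> 'a)"
proof
  fix c
  show "verma_map p (\<rho>V p (p - 1 - s) k v) c = act p s k (verma_map p v :: nat \<Rightarrow> 'a) c"
  proof (cases "c < p \<and> k \<le> Suc c \<and> Suc c - k < p")
    case True
    define m where "m = p - 1 - c"
    have m: "m < p" "1 \<le> m + k" "m + k - 1 < p" "m + k \<le> p" "p - 1 - (Suc c - k) = m + k - 1"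
      "Suc c - k = p - (m + k)"
      using True by (auto simp: m_def)
    have "verma_map p (\<rho>V p (p - 1 - s) k v) c = wcoef m * (cV (p - 1 - s) k (m + k - 1) * v (m + k - 1))"
      using True m unfolding verma_map_def \<rho>V_def m_def[symmetric] by simp
    also have "\<dots> = (of_nat (p - (m + k)) - of_nat (s * k)) * wcoef (m + k - 1) * v (m + k - 1)"
      using cV_wcoef[of s m k] assms(1) m by (simp add: mult.assoc[symmetric])
    also have "\<dots> = act p s k (verma_map p v) c"
      using True m unfolding act_def verma_map_def by simp
    finally show ?thesis .
  next
    case False
    then show ?thesis by (auto simp: verma_map_def \<rho>V_def act_def)
  qed
qed

text \<open>Simplicity of the subquotient with basis \<open>x\<^sup>c\<close>, \<open>c \<in> C\<close>, of a one-variable block, modulo the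
  span of the \<open>x\<^sup>c\<close>, \<open>c \<in> B\<close>.\<close>

definition simple_step :: "nat \<Rightarrow> nat set \<Rightarrow> nat set \<Rightarrow> bool" where
  "simple_step s B C \<longleftrightarrow> (\<forall>K :: (nat \<Rightarrow> 'a) set. subspace K \<and> K \<subseteq> Vcar p \<and>
     (\<forall>k<p. \<forall>v\<in>K. act p s k v \<in> K) \<and> (\<forall>c\<in>B. unit_vec c \<in> K) \<and>
     (\<exists>v\<in>K. v \<noteq> vzero \<and> (\<forall>c. c \<notin> C \<longrightarrow> v c = 0)) \<longrightarrow> (\<forall>c\<in>C. unit_vec c \<in> K))"

text \<open>Each application of \<open>\<partial>\<close> lowers the leading exponent by one and
  multiplies the leading coefficient by the old exponent, which is nonzero in the field because it
  is positive and below \<open>p\<close>.\<close>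

lemma act_lower:
  assumes K: "\<forall>k<p. \<forall>v\<in>K. act p s k v \<in> K" and v: "v \<in> K" "v c \<noteq> (0 :: 'a)" "\<forall>d>c. v d = 0"
    and c: "c0 \<le> c" "c < p"
  shows "\<exists>w\<in>K. w c0 \<noteq> 0 \<and> (\<forall>d>c0. w d = 0)"
  using c v
proof (induction c arbitrary: v rule: dec_induct)
  case (step c)
  let ?w = "act p s 0 v"
  have "?w \<in> K" using K p_gt_2 step.prems by auto
  moreover have "?w c \<noteq> 0"
    using step.prems of_nat_neq_0[of "Suc c"] by (simp add: act_def del: of_nat_Suc)
  moreover have "\<forall>d>c. ?w d = 0"
    using step.prems by (simp add: act_def)
  ultimately show ?case using step.IH[of ?w] step.prems by simp
qed auto

lemma top_coeff:
  assumes "v \<in> Vcar p" "v d \<noteq> (0::'a)"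
  obtains c where "d \<le> c" "c < p" "v c \<noteq> 0" "\<forall>e>c. v e = 0"
proof -
  have fin: "v e \<noteq> 0 \<Longrightarrow> e < p" for e using assms(1) by (auto simp: Vcar_def not_less[symmetric])
  let ?c = "Greatest (\<lambda>e. v e \<noteq> 0)"
  have "v ?c \<noteq> 0" by (rule GreatestI_nat[of _ d p]) (use assms fin in \<open>auto dest: fin\<close>)
  moreover have le: "v e \<noteq> 0 \<Longrightarrow> e \<le> ?c" for e
    by (rule Greatest_le_nat[of _ e p]) (auto dest: fin)
  ultimately show ?thesis using that[of ?c] assms fin by (meson not_less)
qed

lemma act_unit_vec:
  assumes "1 \<le> c + k" "c + k \<le> p" "c < p"
  shows "act p s k (unit_vec c) = vsc (of_nat c - of_nat (s * k)) (unit_vec (c + k - 1) :: nat \<Rightarrow> 'a)"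
  using assms by (auto simp: act_def unit_vec_def vsc_def fun_eq_iff)

lemma unit_vec_from_vsc:
  assumes "subspace K" "vsc a (unit_vec c) \<in> K" "a \<noteq> (0::'a)"
  shows "unit_vec c \<in> K"
proof -
  have "vsc (1 / a) (vsc a (unit_vec c)) \<in> K" using assms by (simp add: subspace_vsc)
  then show ?thesis using assms by (simp add: vsc_def)
qed

text \<open>Lowering reaches \<open>\<partial>\<close> itself, and \<open>x^(c+1) \<partial>\<close>
  sends it to a nonzero multiple of \<open>x^c \<partial>\<close>. This stops at
  \<open>c = p - 2\<close>, since the next step would use \<open>x^p = 0\<close>.\<close>

lemma simple_step_W: "simple_step 1 {} {..<p}"
  unfolding simple_step_def
proof (intro allI impI ballI, elim conjE bexE)
  fix K :: "(nat \<Rightarrow> 'a) set" and c v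
  assume K: "subspace K" "K \<subseteq> Vcar p" "\<forall>k<p. \<forall>v\<in>K. act p 1 k v \<in> K"
    and c: "c \<in> {..<p}" and v: "v \<in> K" "v \<noteq> vzero"
  have vV: "v \<in> Vcar p" using v(1) K(2) by blast
  obtain e where "v e \<noteq> 0" using v(2) unfolding vzero_def by blast
  then obtain d where d: "d < p" "v d \<noteq> 0" "\<forall>e>d. v e = 0"
    using top_coeff[OF vV] by metis
  then obtain w where w: "w \<in> K" "w 0 \<noteq> 0" "\<forall>e>0. w e = 0"
    using act_lower[OF K(3) v(1), of d 0] by auto
  have "w = vsc (w 0) (unit_vec 0)"
    using w by (auto simp: vsc_def unit_vec_def fun_eq_iff)
  then have u0: "unit_vec 0 \<in> K" using w K by (metis unit_vec_from_vsc)
  have low: "unit_vec c \<in> K" if "Suc c < p" for c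
  proof (rule unit_vec_from_vsc[OF K(1)])
    show "vsc (- of_nat (Suc c)) (unit_vec c) \<in> K"
      using K(3) u0 that act_unit_vec[of 0 "Suc c" 1] by (simp del: of_nat_Suc) (metis)
    show "- of_nat (Suc c) \<noteq> (0::'a)" using of_nat_neq_0[of "Suc c"] that by (simp del: of_nat_Suc)
  qed
  show "unit_vec c \<in> K"
  proof (cases "Suc c < p")
    case False
    \<comment> \<open>The top vector is reached from \<open>x \<partial>\<close> instead, by
      \<open>x^(p-1) \<partial>\<close>, with factor \<open>1 - (p - 1)\<close>, which is 2 modulo
      \<open>p\<close> and hence nonzero.\<close>
    have "unit_vec (p - 1) \<in> K"
    proof (rule unit_vec_from_vsc[OF K(1)])
      have "act p 1 (p - 1) (unit_vec 1) \<in> K" using K(3) low[of 1] p_gt_2 by simp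
      then show "vsc (of_nat 1 - of_nat (p - 1)) (unit_vec (p - 1)) \<in> K"
        using act_unit_vec[of 1 "p - 1" 1] p_gt_2 by simp
      show "of_nat 1 - of_nat (p - 1) \<noteq> (0::'a)"
        using of_nat_eq_iff_lt[of 1 "p - 1"] p_gt_2 by simp
    qed
    moreover have "c = p - 1" using False c by auto
    ultimately show ?thesis by simp
  qed (use low in simp)
qed

text \<open>Lowering is stopped at leading exponent 1; the constant term is removed with the help of
  \<open>unit_vec 0\<close>, and \<open>x^c \<partial>\<close> sends \<open>x\<close> to
  \<open>x^c\<close>.\<close>

lemma simple_step_A: "simple_step 0 {0} {1..<p}"
  unfolding simple_step_def
proof (intro allI impI ballI, elim conjE bexE)
  fix K :: "(nat \<Rightarrow> 'a) set" and c v
  assume K: "subspace K" "K \<subseteq> Vcar p" "\<forall>k<p. \<forall>v\<in>K. act p 0 k v \<in> K"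
    and u0: "\<forall>c\<in>{0}. unit_vec c \<in> K"
    and c: "c \<in> {1..<p}" and v: "v \<in> K" "v \<noteq> vzero" "\<forall>c. c \<notin> {1..<p} \<longrightarrow> v c = 0"
  have vV: "v \<in> Vcar p" using v(1) K(2) by blast
  obtain e where e: "v e \<noteq> 0" using v(2) unfolding vzero_def by blast
  then have "1 \<le> e" using v(3) by (metis atLeastLessThan_iff)
  then obtain d where d: "1 \<le> d" "d < p" "v d \<noteq> 0" "\<forall>e>d. v e = 0"
    using top_coeff[OF vV e] by (metis order_trans)
  then obtain w where w: "w \<in> K" "w 1 \<noteq> 0" "\<forall>e>1. w e = 0"
    using act_lower[OF K(3) v(1), of d 1] by auto
  have "vsc (w 1) (unit_vec 1) = vdiff w (vsc (w 0) (unit_vec 0))"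
  proof
    fix x show "vsc (w 1) (unit_vec 1) x = vdiff w (vsc (w 0) (unit_vec 0)) x"
      using w(3) by (cases "x = 0 \<or> x = 1") (auto simp: vdefs unit_vec_def)
  qed
  then have "unit_vec 1 \<in> K"
    using w K u0 by (intro unit_vec_from_vsc[OF K(1), of "w 1"]) (auto intro!: subspace_vdiff subspace_vsc)
  then have "act p 0 c (unit_vec 1) \<in> K" using K(3) c by simp
  then show "unit_vec c \<in> K"
    using act_unit_vec[of 1 c 0] c by (simp add: vsc_def)
qed

lemma simple_step_triv: "simple_step 0 {} {0}"
  unfolding simple_step_def
proof (intro allI impI ballI, elim conjE bexE)
  fix K :: "(nat \<Rightarrow> 'a) set" and c :: nat and v
  assume K: "subspace K" and c: "c \<in> {0}"
    and v: "v \<in> K" "v \<noteq> vzero" "\<forall>c. c \<notin> {0} \<longrightarrow> v c = 0"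
  have eq: "v = vsc (v 0) (unit_vec 0)"
    using v(3) by (auto simp: vsc_def unit_vec_def fun_eq_iff)
  have "v 0 \<noteq> 0"
  proof
    assume "v 0 = 0"
    then have "v = vzero" by (subst eq) (simp add: vdefs)
    with v(2) show False by simp
  qed
  with eq show "unit_vec c \<in> K" using c v(1) unit_vec_from_vsc[OF K, of "v 0" 0] by simp
qed

end

section \<open>Coordinate submodules of W(n)\<close>

definition Idx :: "nat \<Rightarrow> nat \<Rightarrow> (nat \<times> (nat \<Rightarrow> nat)) set" where
  "Idx p n = {..<n} \<times> Mon p n"

text \<open>All submodules in the decomposition and in the explicit series are spanned by monomials,
  so they are handled through their index sets.\<close>

definition coord_space :: "'b set \<Rightarrow> ('b \<Rightarrow> 'a::field) set" where
  "coord_space S = {D. \<forall>q. q \<notin> S \<longrightarrow> D q = 0}"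

definition restr :: "'b set \<Rightarrow> ('b \<Rightarrow> 'a::field) \<Rightarrow> 'b \<Rightarrow> 'a" where
  "restr S D = (\<lambda>q. if q \<in> S then D q else 0)"

text \<open>The index sets whose coordinate spaces are submodules: the action moves a monomial
  \<open>x\<^sup>\<gamma> \<partial>\<^sub>j\<close> only in its \<open>x\<^sub>1\<close>-exponent, and it kills it if \<open>\<gamma> 0 = 0\<close> and \<open>j \<noteq> 0\<close>.\<close>

definition shift_closed :: "nat \<Rightarrow> (nat \<times> (nat \<Rightarrow> nat)) set \<Rightarrow> bool" where
  "shift_closed p S \<longleftrightarrow>
     (\<forall>j \<gamma> c. (j, \<gamma>) \<in> S \<and> (j = 0 \<or> \<gamma> 0 \<noteq> 0) \<and> c < p \<longrightarrow> (j, \<gamma>(0 := c)) \<in> S)"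

definition blk :: "nat \<Rightarrow> (nat \<Rightarrow> nat) \<Rightarrow> nat set \<Rightarrow> (nat \<times> (nat \<Rightarrow> nat)) set" where
  "blk j \<beta> C = (\<lambda>c. (j, \<beta>(0 := c))) ` C"

definition emb :: "nat \<Rightarrow> nat \<Rightarrow> (nat \<Rightarrow> nat) \<Rightarrow> (nat \<Rightarrow> 'a::field) \<Rightarrow> nat \<times> (nat \<Rightarrow> nat) \<Rightarrow> 'a" where
  "emb p j \<beta> v = (\<lambda>(j', \<gamma>). if j' = j \<and> \<gamma>(0 := 0) = \<beta> \<and> \<gamma> 0 < p then v (\<gamma> 0) else 0)"

lemma subspace_coord_space: "subspace (coord_space S)"
  by (auto simp: subspace_def coord_space_def vdefs)

lemma coord_space_empty: "coord_space {} = {vzero}"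
  by (auto simp: coord_space_def vzero_def)

lemma coord_space_mono: "S \<subseteq> T \<Longrightarrow> coord_space S \<subseteq> coord_space T"
  by (auto simp: coord_space_def)

lemma restr_in_coord_space: "restr S D \<in> coord_space S"
  by (auto simp: restr_def coord_space_def)

lemma Wcar_eq: "Wcar p n = coord_space (Idx p n)"
  by (auto simp: Wcar_def coord_space_def Idx_def)

lemma blk_iff: "\<beta> 0 = 0 \<Longrightarrow> (j', \<gamma>) \<in> blk j \<beta> C \<longleftrightarrow> j' = j \<and> \<gamma>(0 := 0) = \<beta> \<and> \<gamma> 0 \<in> C"
  by (force simp: blk_def fun_eq_iff)

lemma emb_at: "\<beta> 0 = 0 \<Longrightarrow> c < p \<Longrightarrow> emb p j \<beta> v (j, \<beta>(0 := c)) = v c"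
  by (auto simp: emb_def fun_eq_iff)

lemma emb_in_blk:
  assumes "\<beta> 0 = 0" "\<And>c. c < p \<Longrightarrow> c \<notin> C \<Longrightarrow> v c = 0"
  shows "emb p j \<beta> v \<in> coord_space (blk j \<beta> C)"
  unfolding coord_space_def using assms by (auto simp: emb_def blk_iff)

lemma coord_space_blk_emb:
  assumes "\<beta> 0 = 0" "C \<subseteq> {..<p}" "D \<in> coord_space (blk j \<beta> C)"
  obtains v where "v \<in> Vcar p" "\<And>c. c \<notin> C \<Longrightarrow> v c = 0" "D = emb p j \<beta> v"
proof (rule that)
  let ?v = "\<lambda>c. if c \<in> C then D (j, \<beta>(0 := c)) else 0"
  show "?v \<in> Vcar p" using assms(2) by (auto simp: Vcar_def)
  show "D = emb p j \<beta> ?v"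
  proof
    fix q :: "nat \<times> (nat \<Rightarrow> nat)"
    obtain j' \<gamma> where q: "q = (j', \<gamma>)" by fastforce
    show "D q = emb p j \<beta> ?v q"
    proof (cases "q \<in> blk j \<beta> C")
      case True
      then have "j' = j" "\<gamma> = \<beta>(0 := \<gamma> 0)" "\<gamma> 0 \<in> C" "\<gamma>(0 := 0) = \<beta>"
        using assms(1) by (auto simp: q blk_iff)
      then show ?thesis using assms(2) by (auto simp: q emb_def)
    next
      case False
      then have "D q = 0" using assms(3) unfolding coord_space_def by blast
      moreover have "emb p j \<beta> ?v q = 0" using False assms(1) by (auto simp: q emb_def blk_iff)
      ultimately show ?thesis by simp
    qed
  qed
qed simp

lemma emb_lin:
  "emb p j \<beta> (vadd u v) = vadd (emb p j \<beta> u) (emb p j \<beta> v)"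
  "emb p j \<beta> (vsc c v) = vsc c (emb p j \<beta> v)"
  "emb p j \<beta> vzero = vzero"
  by (auto simp: emb_def vdefs fun_eq_iff)

lemma shift_closed_blk: "\<beta> 0 = 0 \<Longrightarrow> shift_closed p (blk j \<beta> {..<p})"
  by (auto simp: shift_closed_def blk_iff)

lemma shift_closed_empty: "shift_closed p {}"
  by (simp add: shift_closed_def)

lemma bij_emb:
  assumes "\<beta> 0 = 0"
  shows "bij_betw (emb p j \<beta>) (Vcar p) (coord_space (blk j \<beta> {..<p}))"
  unfolding bij_betw_def
proof
  show "inj_on (emb p j \<beta>) (Vcar p)"
  proof (rule inj_onI)
    fix u v assume uv: "u \<in> Vcar p" "v \<in> Vcar p" "emb p j \<beta> u = emb p j \<beta> v"
    show "u = v"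
    proof
      fix c show "u c = v c"
        using uv emb_at[of \<beta> c p j u] emb_at[of \<beta> c p j v] assms
        by (cases "c < p") (auto simp: Vcar_def)
    qed
  qed
  show "emb p j \<beta> ` Vcar p = coord_space (blk j \<beta> {..<p})"
  proof
    show "emb p j \<beta> ` Vcar p \<subseteq> coord_space (blk j \<beta> {..<p})"
      using assms by (auto intro!: emb_in_blk)
    show "coord_space (blk j \<beta> {..<p}) \<subseteq> emb p j \<beta> ` Vcar p"
      using coord_space_blk_emb[of \<beta>, OF assms subset_refl] by (metis image_eqI subsetI)
  qed
qed

section \<open>The action on blocks and the labels of their simple layers\<close>

context witt_setting
begin

abbreviation WC :: "(nat \<times> (nat \<Rightarrow> nat) \<Rightarrow> 'a) set" where "WC \<equiv> Wcar p n"

lemma subspace_WC: "subspace WC"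
  by (simp add: Wcar_eq subspace_coord_space)

lemma lin_on_\<rho>W: "k < p \<Longrightarrow> lin_on WC (\<rho>W p n k)"
  unfolding lin_on_def
proof (intro conjI ballI allI)
  fix u v :: "nat \<times> (nat \<Rightarrow> nat) \<Rightarrow> 'a" and c
  assume k: "k < p" and v: "v \<in> WC"
  note cv = \<rho>W_coord[OF k n_pos v]
  show "\<rho>W p n k (vsc c v) = vsc c (\<rho>W p n k v)"
    using \<rho>W_coord[OF k n_pos, of "vsc c v"] subspace_vsc[OF subspace_WC v]
    by (auto simp: fun_eq_iff cv vsc_def)
  assume u: "u \<in> WC"
  show "\<rho>W p n k (vadd u v) = vadd (\<rho>W p n k u) (\<rho>W p n k v)"
    using \<rho>W_coord[OF k n_pos, of "vadd u v"] subspace_vadd[OF subspace_WC u v]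
    by (auto simp: fun_eq_iff cv \<rho>W_coord[OF k n_pos u] vadd_def algebra_simps)
qed

text \<open>A nonzero coefficient at \<open>(j, \<gamma>)\<close> comes from a monomial in
  \<open>S\<close> that differs only in place 0, with a nonzero factor. For
  \<open>j \<noteq> 0\<close> this factor is the \<open>x_1\<close>-exponent of the source, which is
  therefore nonzero: exactly the case in which \<open>shift_closed\<close> provides the
  move.\<close>

lemma submodule_coord_space:
  assumes S: "S \<subseteq> Idx p n" "shift_closed p S"
  shows "submodule p (\<rho>W p n) WC (coord_space S)"
  unfolding submodule_def
proof (intro conjI allI impI ballI)
  show sub: "coord_space S \<subseteq> WC" using S by (simp add: Wcar_eq coord_space_mono)
  show "subspace (coord_space S :: (_ \<Rightarrow> 'a) set)" by (rule subspace_coord_space)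
  fix k and D :: "_ \<Rightarrow> 'a" assume k: "k < p" and D: "D \<in> coord_space S"
  have "(j, \<gamma>) \<in> S" if nz: "\<rho>W p n k D (j, \<gamma>) \<noteq> 0" for j \<gamma>
  proof -
    let ?a = "Suc (\<gamma> 0) - k"
    have D': "D \<in> WC" using sub D by blast
    have h: "\<gamma> \<in> Mon p n" "?a < p" "D (j, \<gamma>(0 := ?a)) \<noteq> 0"
      "(of_nat ?a - (if j = 0 then of_nat k else 0) :: 'a) \<noteq> 0"
      using nz unfolding \<rho>W_coord[OF k n_pos D'] by (auto split: if_splits)
    have "(j, \<gamma>(0 := ?a)) \<in> S" using h(3) D by (auto simp: coord_space_def)
    moreover have "j = 0 \<or> (\<gamma>(0 := ?a)) 0 \<noteq> 0" using h(4) by (auto split: if_splits)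
    moreover have "\<gamma> 0 < p" using Mon_lt[OF h(1) n_pos] .
    ultimately have "(j, (\<gamma>(0 := ?a))(0 := \<gamma> 0)) \<in> S"
      using S(2) unfolding shift_closed_def by blast
    then show ?thesis by simp
  qed
  then show "\<rho>W p n k D \<in> coord_space S" unfolding coord_space_def by auto
qed

lemma blk_subset_Idx: "j < n \<Longrightarrow> \<beta> \<in> Mon0 p n \<Longrightarrow> C \<subseteq> {..<p} \<Longrightarrow> blk j \<beta> C \<subseteq> Idx p n"
  using n_pos by (auto simp: blk_def Idx_def Mon0_def Mon_upd0)

text \<open>Index 0 stands for \<open>\<partial>_1\<close>, so \<open>of_bool (j = 0)\<close> is the
  parameter \<open>s\<close> of the one-variable action.\<close>

lemma \<rho>W_emb:
  assumes "j < n" "\<beta> \<in> Mon0 p n" "k < p"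
  shows "\<rho>W p n k (emb p j \<beta> v) = emb p j \<beta> (act p (of_bool (j = 0)) k v :: nat \<Rightarrow> 'a)"
proof
  fix q :: "nat \<times> (nat \<Rightarrow> nat)"
  obtain j' \<gamma> where q: "q = (j', \<gamma>)" by fastforce
  have \<beta>: "\<beta> 0 = 0" "\<beta> \<in> Mon p n" using assms by (auto simp: Mon0_def)
  have "emb p j \<beta> v \<in> coord_space (blk j \<beta> {..<p})" using \<beta> by (intro emb_in_blk) auto
  then have W: "emb p j \<beta> v \<in> WC"
    using blk_subset_Idx[OF assms(1,2) subset_refl] unfolding Wcar_eq by (meson coord_space_mono subsetD)
  have mon: "\<gamma> \<in> Mon p n" if "\<gamma>(0 := 0) = \<beta>" "\<gamma> 0 < p"
  proof -
    have "\<gamma> = \<beta>(0 := \<gamma> 0)" using that by auto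
    then show ?thesis using Mon_upd0[OF \<beta>(2) that(2) n_pos] by simp
  qed
  show "\<rho>W p n k (emb p j \<beta> v) q = emb p j \<beta> (act p (of_bool (j = 0)) k v) q"
    unfolding q \<rho>W_coord[OF assms(3) n_pos W] using assms(1) mon n_pos Mon_lt[of \<gamma> p n]
    by (auto simp: emb_def act_def)
qed

text \<open>Simplicity is reduced to one variable by pulling an intermediate \<open>K\<close> back
  along \<open>emb\<close>. A vector of \<open>K\<close> outside \<open>coord_space S\<close> loses
  its \<open>S\<close>-part, which lies in \<open>K\<close> anyway, and becomes a nonzero vector
  supported on \<open>C\<close>. The set \<open>B\<close> records monomials of the same block
  already present in \<open>S\<close>; they matter for the layer above the constants.\<close>

lemma simple_sq_block:
  assumes S: "S \<subseteq> Idx p n" "shift_closed p S" "shift_closed p (S \<union> blk j \<beta> C)"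
    and j: "j < n" "\<beta> \<in> Mon0 p n" and C: "C \<subseteq> {..<p}" "C \<noteq> {}" "B \<subseteq> {..<p}"
    and disj: "blk j \<beta> C \<inter> S = {}" "blk j \<beta> B \<subseteq> S"
    and step: "simple_step (of_bool (j = 0)) B C"
  shows "simple_sq p (\<rho>W p n) WC (coord_space S) (coord_space (S \<union> blk j \<beta> C))"
  unfolding simple_sq_def
proof (intro conjI allI impI)
  let ?T = "blk j \<beta> C" and ?e = "emb p j \<beta> :: (nat \<Rightarrow> 'a) \<Rightarrow> _"
  have \<beta>: "\<beta> 0 = 0" using j by (simp add: Mon0_def)
  show "submodule p (\<rho>W p n) WC (coord_space S)" using S by (intro submodule_coord_space)
  show "submodule p (\<rho>W p n) WC (coord_space (S \<union> ?T))"
    using S blk_subset_Idx[OF j C(1)] by (intro submodule_coord_space) auto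
  obtain c0 where c0: "c0 \<in> C" using C by auto
  have e0: "?e (unit_vec c0) \<in> coord_space ?T"
    using \<beta> c0 by (intro emb_in_blk) (auto simp: unit_vec_def)
  have "?e (unit_vec c0) (j, \<beta>(0 := c0)) = 1"
    using emb_at[of \<beta> c0 p j "unit_vec c0"] \<beta> c0 C by (auto simp: unit_vec_def)
  moreover have "(j, \<beta>(0 := c0)) \<notin> S" using disj(1) c0 by (auto simp: blk_def)
  ultimately have "?e (unit_vec c0) \<notin> coord_space S"
    unfolding coord_space_def by (metis (mono_tags, lifting) mem_Collect_eq one_neq_zero)
  then show "coord_space S \<subset> (coord_space (S \<union> ?T) :: (_ \<Rightarrow> 'a) set)"
    using coord_space_mono[of S "S \<union> ?T"] coord_space_mono[of ?T "S \<union> ?T"] e0 by blast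
  fix K assume "submodule p (\<rho>W p n) WC K \<and> coord_space S \<subseteq> K \<and> K \<subseteq> coord_space (S \<union> ?T)"
  then have sK: "submodule p (\<rho>W p n) WC K" and SK: "coord_space S \<subseteq> K" and KT: "K \<subseteq> coord_space (S \<union> ?T)"
    by auto
  have ssK: "subspace K" using sK by (simp add: submodule_def)
  have split: "E = vadd (restr S E) (restr ?T E)" if "E \<in> coord_space (S \<union> ?T)" for E :: "_ \<Rightarrow> 'a"
    using that disj(1) by (fastforce simp: vadd_def restr_def coord_space_def fun_eq_iff)
  have rS: "restr S E \<in> K" for E using restr_in_coord_space[of S E] SK by blast
  let ?K = "{v \<in> Vcar p. ?e v \<in> K}"
  show "K = coord_space S \<or> K = coord_space (S \<union> ?T)"
  proof (rule disjCI)
    assume "K \<noteq> coord_space (S \<union> ?T)"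
    have "K \<subseteq> coord_space S"
    proof (rule ccontr)
      assume "\<not> K \<subseteq> coord_space S"
      then obtain D where D: "D \<in> K" "D \<notin> coord_space S" by blast
      then have DT: "D \<in> coord_space (S \<union> ?T)" using KT by blast
      have "restr ?T D = vdiff D (restr S D)"
        using fun_cong[OF split[OF DT]] by (auto simp: vdefs fun_eq_iff)
      then have rT: "restr ?T D \<in> K" using subspace_vdiff[OF ssK D(1) rS[of D]] by simp
      obtain v where v: "v \<in> Vcar p" "\<And>c. c \<notin> C \<Longrightarrow> v c = 0" "restr ?T D = ?e v"
        using coord_space_blk_emb[of \<beta>, OF \<beta> C(1) restr_in_coord_space] by blast
      have "v \<noteq> vzero"
      proof
        assume "v = vzero"
        then have "D = restr S D" using v(3) split[OF DT] by (simp add: emb_lin) (simp add: vdefs)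
        then show False using D(2) restr_in_coord_space[of S D] by simp
      qed
      moreover have "v \<in> ?K" using v rT by simp
      moreover have "subspace ?K"
        using subspace_Vcar[of p] ssK by (auto simp: subspace_def emb_lin)
      moreover have "\<forall>k<p. \<forall>v\<in>?K. act p (of_bool (j = 0)) k v \<in> ?K"
      proof (intro allI impI ballI)
        fix k v assume k: "k < p" and v: "v \<in> ?K"
        then have "\<rho>W p n k (?e v) \<in> K" using sK by (auto simp: submodule_def)
        then show "act p (of_bool (j = 0)) k v \<in> ?K"
          using \<rho>W_emb[OF j k, of v] by (simp add: act_in_Vcar)
      qed
      moreover have "\<forall>c\<in>B. unit_vec c \<in> ?K"
      proof
        fix c assume c: "c \<in> B"
        then have "?e (unit_vec c) \<in> coord_space (blk j \<beta> B)"
          using \<beta> by (intro emb_in_blk) (auto simp: unit_vec_def)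
        then have "?e (unit_vec c) \<in> K" using coord_space_mono[OF disj(2)] SK by blast
        moreover have "unit_vec c \<in> Vcar p" using c C by (intro unit_vec_in_Vcar) auto
        ultimately show "unit_vec c \<in> ?K" by simp
      qed
      ultimately have units: "\<forall>c\<in>C. unit_vec c \<in> ?K"
        using step v(2) unfolding simple_step_def by blast
      have "coord_space (S \<union> ?T) \<subseteq> K"
      proof
        fix E :: "_ \<Rightarrow> 'a" assume E: "E \<in> coord_space (S \<union> ?T)"
        obtain w where w: "w \<in> Vcar p" "\<And>c. c \<notin> C \<Longrightarrow> w c = 0" "restr ?T E = ?e w"
          using coord_space_blk_emb[of \<beta>, OF \<beta> C(1) restr_in_coord_space] by blast
        \<comment> \<open>Outside \<open>C\<close> the coefficient \<open>w m\<close> is 0, so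
          \<open>vzero\<close> may stand in for a \<open>unit_vec m\<close> that is not known to lie
          in \<open>?K\<close>.\<close>
        have "(\<lambda>x. \<Sum>m<p. w m * (if m \<in> C then unit_vec m else vzero) x) \<in> ?K"
          using units \<open>subspace ?K\<close> subspace_vzero by (intro subspace_lincomb) auto
        also have "(\<lambda>x. \<Sum>m<p. w m * (if m \<in> C then unit_vec m else vzero) x)
            = (\<lambda>x. \<Sum>m<p. w m * unit_vec m x)"
          using w(2) by (intro ext sum.cong) auto
        also have "\<dots> = w" using Vcar_lincomb[OF w(1)] by simp
        finally have "restr ?T E \<in> K" using w(3) by simp
        then show "E \<in> K" using split[OF E] rS[of E] ssK by (metis subspace_vadd)
      qed
      with KT \<open>K \<noteq> coord_space (S \<union> ?T)\<close> show False by blast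
    qed
    with SK show "K = coord_space S" by blast
  qed
qed

text \<open>A singular vector need not be a monomial. But \<open>x_1^k \<partial>_1\<close> shifts
  all \<open>x_1\<close>-exponents by the same amount, so different monomials cannot cancel, and any
  monomial of it outside \<open>S\<close> satisfies the weight and annihilation conditions by
  itself, as long as the shifted exponent stays in \<open>C\<close>.\<close>

lemma is_L_sq_block_weight:
  assumes L: "is_L_sq p lam (\<rho>W p n) WC (coord_space S) (coord_space (S \<union> blk j \<beta> C))"
    and j: "j < n" "\<beta> \<in> Mon0 p n" and C: "C \<subseteq> {..<p}" and disj: "blk j \<beta> C \<inter> S = {}"
  obtains c where "c \<in> C" "of_nat c - of_bool (j = 0) = (of_nat lam :: 'a)"
    "\<forall>k. 2 \<le> k \<longrightarrow> k < p \<longrightarrow> c + k - 1 \<in> C \<longrightarrow> (of_nat c :: 'a) = of_nat (of_bool (j = 0) * k)"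
proof -
  have \<beta>: "\<beta> 0 = 0" "\<beta> \<in> Mon p n" using j by (auto simp: Mon0_def)
  have p1: "1 < p" using p_gt_2 by simp
  obtain m :: "nat \<times> (nat \<Rightarrow> nat) \<Rightarrow> 'a" where m: "m \<in> coord_space (S \<union> blk j \<beta> C)" "m \<notin> coord_space S"
    "\<forall>k. 2 \<le> k \<longrightarrow> k < p \<longrightarrow> \<rho>W p n k m \<in> coord_space S"
    "vdiff (\<rho>W p n 1 m) (vsc (of_nat lam) m) \<in> coord_space S"
    by (rule is_L_sq_singular_vector[OF L p1]) blast
  have "m \<in> WC" using m(1) L by (auto simp: is_L_sq_def simple_sq_def submodule_def)
  note coord = \<rho>W_coord[OF _ n_pos this]
  obtain q where "q \<notin> S" "m q \<noteq> 0" using m(2) by (auto simp: coord_space_def)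
  then have "q \<in> blk j \<beta> C" using m(1) unfolding coord_space_def by blast
  then obtain c where c: "c \<in> C" "m (j, \<beta>(0 := c)) \<noteq> 0" using \<open>m q \<noteq> 0\<close> by (auto simp: blk_def)
  have notS: "(j, \<beta>(0 := d)) \<notin> S" if "d \<in> C" for d
    using disj that by (auto simp: blk_def)
  have val: "\<rho>W p n k m (j, \<beta>(0 := c + k - 1)) = (of_nat c - of_nat (of_bool (j = 0) * k)) * m (j, \<beta>(0 := c))"
    if "k < p" "c + k - 1 \<in> C" "1 \<le> k" for k
  proof -
    have "c < p" using c C by auto
    moreover have "\<beta>(0 := c + k - 1) \<in> Mon p n" using that C \<beta> n_pos by (intro Mon_upd0) auto
    moreover have "Suc (c + k - 1) - k = c" using that by simp
    ultimately show ?thesis using that j unfolding coord[OF that(1)] by simp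
  qed
  show ?thesis
  proof (rule that[OF c(1)], goal_cases)
    case 1
    have "vdiff (\<rho>W p n 1 m) (vsc (of_nat lam) m) (j, \<beta>(0 := c)) = 0"
      using m(4) notS[OF c(1)] by (auto simp: coord_space_def)
    then have "((of_nat c - of_bool (j = 0)) - of_nat lam) * m (j, \<beta>(0 := c)) = 0"
      using val[of 1] c p_gt_2 by (simp add: vdefs algebra_simps)
    then show ?case using c by simp
  next
    case 2
    have "(of_nat c :: 'a) = of_nat (of_bool (j = 0) * k)" if k: "2 \<le> k" "k < p" "c + k - 1 \<in> C" for k
    proof -
      have "\<rho>W p n k m (j, \<beta>(0 := c + k - 1)) = 0"
        using m(3) k(1,2) notS[OF k(3)] by (auto simp: coord_space_def)
      then show ?thesis
        using val[of k] k c by simp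
    qed
    then show ?case by blast
  qed
qed

lemma emb_verma_lin: "lin_on (Vcar p) (emb p j \<beta> \<circ> (verma_map p :: (nat \<Rightarrow> 'a) \<Rightarrow> _))"
proof -
  have "verma_map p (vadd u v) = vadd (verma_map p u) (verma_map p v)"
    "verma_map p (vsc c v) = vsc c (verma_map p v)" for u v :: "nat \<Rightarrow> 'a" and c
    by (auto simp: verma_map_def vdefs algebra_simps fun_eq_iff)
  then show ?thesis by (simp add: lin_on_def emb_lin)
qed

lemma emb_verma_hom:
  assumes "j < n" "\<beta> \<in> Mon0 p n" "k < p"
  shows "(emb p j \<beta> \<circ> verma_map p) (\<rho>V p (p - 1 - of_bool (j = 0)) k v)
       = \<rho>W p n k ((emb p j \<beta> \<circ> verma_map p) (v :: nat \<Rightarrow> 'a))"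
  using verma_map_hom[of "of_bool (j = 0)" k v] \<rho>W_emb[OF assms, of "verma_map p v"] assms(3)
  by simp

lemma bij_emb_verma:
  assumes "\<beta> \<in> Mon0 p n"
  shows "bij_betw (emb p j \<beta> \<circ> verma_map p) (Vcar p) (coord_space (blk j \<beta> {..<p}) :: (_ \<Rightarrow> 'a) set)"
proof -
  have "\<beta> 0 = 0" using assms by (simp add: Mon0_def)
  then show ?thesis using bij_betw_trans[OF bij_verma_map bij_emb[of \<beta>]] by blast
qed

lemma iso_V_block:
  assumes "0 < j" "j < n" "\<beta> \<in> Mon0 p n"
  shows "iso_V p (p - 1) (\<rho>W p n) (coord_space (blk j \<beta> {..<p}) :: (_ \<Rightarrow> 'a) set)"
  unfolding iso_V_def
proof (intro exI conjI allI impI ballI)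
  show "lin_on (Vcar p) (emb p j \<beta> \<circ> (verma_map p :: (nat \<Rightarrow> 'a) \<Rightarrow> _))" by (rule emb_verma_lin)
  show "bij_betw (emb p j \<beta> \<circ> verma_map p) (Vcar p) (coord_space (blk j \<beta> {..<p}) :: (_ \<Rightarrow> 'a) set)"
    using assms by (intro bij_emb_verma)
  fix i and v :: "nat \<Rightarrow> 'a" assume "i < p"
  then show "(emb p j \<beta> \<circ> verma_map p) (\<rho>V p (p - 1) i v) = \<rho>W p n i ((emb p j \<beta> \<circ> verma_map p) v)"
    using emb_verma_hom[of j \<beta> i v] assms by simp
qed

text \<open>When \<open>S\<close> contains the rest of the block, the isomorphism from the Verma
  module onto the full block is still onto the layer modulo \<open>S\<close>. A layer consisting of
  the constants alone is not of this kind and gets its own map below.\<close>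

lemma is_L_sq_block:
  assumes simple: "simple_sq p (\<rho>W p n) WC (coord_space S) (coord_space (S \<union> blk j \<beta> C))"
    and j: "j < n" "\<beta> \<in> Mon0 p n" and full: "blk j \<beta> {..<p} \<subseteq> S \<union> blk j \<beta> C" and C: "C \<subseteq> {..<p}"
  shows "is_L_sq p (p - 1 - of_bool (j = 0)) (\<rho>W p n) WC (coord_space S) (coord_space (S \<union> blk j \<beta> C))"
  unfolding is_L_sq_def
proof (intro conjI simple exI allI impI ballI)
  let ?f = "emb p j \<beta> \<circ> (verma_map p :: (nat \<Rightarrow> 'a) \<Rightarrow> _)" and ?B = "blk j \<beta> {..<p}"
  show "lin_on (Vcar p) ?f" by (rule emb_verma_lin)
  have im: "?f ` Vcar p = coord_space ?B" using bij_emb_verma[OF j(2), of j] by (simp add: bij_betw_def)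
  then show "?f ` Vcar p \<subseteq> coord_space (S \<union> blk j \<beta> C)" using coord_space_mono[OF full] by simp
  show "vdiff (?f (\<rho>V p (p - 1 - of_bool (j = 0)) i v)) (\<rho>W p n i (?f v)) \<in> coord_space S" if "i < p" for i v
    using emb_verma_hom[OF j that, of v] by (simp add: vdefs coord_space_def)
  fix m :: "_ \<Rightarrow> 'a" assume m: "m \<in> coord_space (S \<union> blk j \<beta> C)"
  have "restr ?B m \<in> ?f ` Vcar p" using restr_in_coord_space im by blast
  then obtain v where v: "v \<in> Vcar p" "restr ?B m = ?f v" by blast
  have "blk j \<beta> C \<subseteq> ?B" using C by (auto simp: blk_def)
  then have "vdiff m (restr ?B m) \<in> coord_space S"
    using m unfolding coord_space_def vdiff_def restr_def by auto
  then show "\<exists>v\<in>Vcar p. vdiff m (?f v) \<in> coord_space S" using v by metis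
qed

text \<open>For the converse, let \<open>x_1^c\<close> occur in a singular vector. If
  \<open>c < p - 1\<close>, annihilation by \<open>x_1^2 \<partial>_1\<close> forces
  \<open>c = 2\<close> and annihilation by \<open>x_1^3 \<partial>_1\<close> forces
  \<open>c = 3\<close>. So \<open>c = p - 1\<close>, which has weight \<open>p - 2\<close>.\<close>

lemma is_L_sq_block_W:
  assumes S: "S \<subseteq> Idx p n" "shift_closed p S" "blk 0 \<beta> {..<p} \<inter> S = {}" and \<beta>: "\<beta> \<in> Mon0 p n"
    and lam: "lam < p"
  shows "is_L_sq p lam (\<rho>W p n) WC (coord_space S) (coord_space (S \<union> blk 0 \<beta> {..<p})) \<longleftrightarrow> lam = p - 2"
proof
  have \<beta>0: "\<beta> 0 = 0" using \<beta> by (simp add: Mon0_def)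
  have "shift_closed p (S \<union> blk 0 \<beta> {..<p})"
    using S(2) shift_closed_blk[of \<beta> p 0] \<beta>0 by (auto simp: shift_closed_def)
  then have simple: "simple_sq p (\<rho>W p n) WC (coord_space S) (coord_space (S \<union> blk 0 \<beta> {..<p}))"
    using S \<beta> simple_step_W p_gt_2 n_pos
    by (intro simple_sq_block[where B = "{}"]) (auto simp: blk_def)
  assume "lam = p - 2"
  then show "is_L_sq p lam (\<rho>W p n) WC (coord_space S) (coord_space (S \<union> blk 0 \<beta> {..<p}))"
    using is_L_sq_block[OF simple n_pos \<beta>] by (simp add: numeral_2_eq_2)
next
  assume "is_L_sq p lam (\<rho>W p n) WC (coord_space S) (coord_space (S \<union> blk 0 \<beta> {..<p}))"
  then obtain c where c: "c \<in> {..<p}" "of_nat c - of_bool True = (of_nat lam :: 'a)"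
    "\<forall>k. 2 \<le> k \<longrightarrow> k < p \<longrightarrow> c + k - 1 \<in> {..<p} \<longrightarrow> (of_nat c :: 'a) = of_nat (of_bool True * k)"
    using is_L_sq_block_weight[of lam S 0 \<beta> "{..<p}"] n_pos \<beta> S(3) by auto
  have "c = p - 1"
  proof (rule ccontr)
    assume "c \<noteq> p - 1"
    then have c1: "c + 1 < p" using c(1) by auto
    then have "(of_nat c :: 'a) = of_nat 2" using c(3)[rule_format, of 2] p_gt_2 by simp
    then have "c = 2" using of_nat_eq_iff_lt[of c 2] p_gt_2 c(1) by simp
    \<comment> \<open>The condition for \<open>k = 3\<close> concerns exponent
      \<open>c + 2 = 4\<close>, so it is available only if \<open>p > 4\<close>; primality closes
      the gap left by \<open>3 < p\<close>.\<close>
    moreover have "p \<noteq> 4" using prime_p primes_dvd_imp_eq[OF two_is_prime_nat prime_p] p_gt_2 by auto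
    ultimately have "p > 4" using c1 by simp
    then have "(of_nat c :: 'a) = of_nat 3" using c(3)[rule_format, of 3] \<open>c = 2\<close> by simp
    then show False using of_nat_eq_iff_lt[of c 3] \<open>p > 4\<close> \<open>c = 2\<close> by simp
  qed
  then have "(of_nat (p - 2) :: 'a) = of_nat lam" using c(2) p_gt_2 by (simp add: of_nat_diff)
  then show "lam = p - 2" using of_nat_eq_iff_lt[of "p - 2" lam] lam p_gt_2 by simp
qed

text \<open>Above the constants, \<open>x_1^2 \<partial>_1\<close> multiplies the coefficient of
  \<open>x_1^c\<close> by \<open>c\<close>, which is nonzero, and moves it to
  \<open>x_1^(c+1)\<close>. Only the top exponent \<open>p - 1\<close> survives as singular, and its
  weight is itself.\<close>

lemma is_L_sq_block_A:
  assumes S: "S \<subseteq> Idx p n" "shift_closed p S" "blk j \<beta> {1..<p} \<inter> S = {}" "blk j \<beta> {0} \<subseteq> S"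
    and j: "0 < j" "j < n" and \<beta>: "\<beta> \<in> Mon0 p n" and lam: "lam < p"
  shows "is_L_sq p lam (\<rho>W p n) WC (coord_space S) (coord_space (S \<union> blk j \<beta> {1..<p})) \<longleftrightarrow> lam = p - 1"
proof
  have \<beta>0: "\<beta> 0 = 0" using \<beta> by (simp add: Mon0_def)
  have "{..<p} = {0} \<union> {1..<p}" using p_gt_2 by auto
  then have full: "blk j \<beta> {..<p} = blk j \<beta> {0} \<union> blk j \<beta> {1..<p}"
    unfolding blk_def by (metis image_Un)
  have "shift_closed p (S \<union> blk j \<beta> {..<p})"
    using S(2) shift_closed_blk[of \<beta> p j] \<beta>0 by (auto simp: shift_closed_def)
  moreover have "S \<union> blk j \<beta> {..<p} = S \<union> blk j \<beta> {1..<p}" using full S(4) by auto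
  ultimately have closed: "shift_closed p (S \<union> blk j \<beta> {1..<p})" by simp
  have simple: "simple_sq p (\<rho>W p n) WC (coord_space S) (coord_space (S \<union> blk j \<beta> {1..<p}))"
    using S \<beta> simple_step_A p_gt_2 j
    by (intro simple_sq_block[where B = "{0}", OF S(1,2) closed]) auto
  have full': "blk j \<beta> {..<p} \<subseteq> S \<union> blk j \<beta> {1..<p}" "{1..<p} \<subseteq> {..<p}"
    using full S(4) by auto
  assume "lam = p - 1"
  then show "is_L_sq p lam (\<rho>W p n) WC (coord_space S) (coord_space (S \<union> blk j \<beta> {1..<p}))"
    using is_L_sq_block[OF simple j(2) \<beta>] full' j by simp
next
  assume "is_L_sq p lam (\<rho>W p n) WC (coord_space S) (coord_space (S \<union> blk j \<beta> {1..<p}))"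
  then obtain c where c: "c \<in> {1..<p}" "of_nat c - of_bool (j = 0) = (of_nat lam :: 'a)"
    "\<forall>k. 2 \<le> k \<longrightarrow> k < p \<longrightarrow> c + k - 1 \<in> {1..<p} \<longrightarrow> (of_nat c :: 'a) = of_nat (of_bool (j = 0) * k)"
    using is_L_sq_block_weight[of lam S j \<beta> "{1..<p}"] j \<beta> S(3) by (auto simp: subset_eq)
  have "\<not> c + 1 < p"
  proof
    assume "c + 1 < p"
    then have "(of_nat c :: 'a) = 0" using c(3)[rule_format, of 2] p_gt_2 j by simp
    then show False using of_nat_neq_0[of c] c(1) by simp
  qed
  then have "c = p - 1" using c(1) by auto
  moreover have "c = lam" using c(1,2) j lam of_nat_eq_iff_lt[of c lam] by simp
  ultimately show "lam = p - 1" by simp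
qed

text \<open>The map from \<open>V(0)\<close> keeps only the coefficient of \<open>v_0\<close>.
  Conversely, the constants have weight 0.\<close>

lemma is_L_sq_block_triv:
  assumes S: "S \<subseteq> Idx p n" "shift_closed p S" "blk j \<beta> {0} \<inter> S = {}"
    and j: "0 < j" "j < n" and \<beta>: "\<beta> \<in> Mon0 p n" and lam: "lam < p"
  shows "is_L_sq p lam (\<rho>W p n) WC (coord_space S) (coord_space (S \<union> blk j \<beta> {0})) \<longleftrightarrow> lam = 0"
proof
  have \<beta>0: "\<beta> 0 = 0" using \<beta> by (simp add: Mon0_def)
  have closed: "shift_closed p (S \<union> blk j \<beta> {0})"
    using S(2) j(1) \<beta>0 by (auto simp: shift_closed_def blk_def)
  have simple: "simple_sq p (\<rho>W p n) WC (coord_space S) (coord_space (S \<union> blk j \<beta> {0}))"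
    using S \<beta> simple_step_triv p_gt_2 j
    by (intro simple_sq_block[where B = "{}", OF S(1,2) closed]) (auto simp: blk_def)
  assume lam: "lam = 0"
  show "is_L_sq p lam (\<rho>W p n) WC (coord_space S) (coord_space (S \<union> blk j \<beta> {0}))"
    unfolding is_L_sq_def
  proof (intro conjI simple exI allI impI ballI)
    let ?f = "\<lambda>v :: nat \<Rightarrow> 'a. emb p j \<beta> (vsc (v 0) (unit_vec 0))"
    show "lin_on (Vcar p) ?f"
      by (auto simp: lin_on_def emb_def vdefs fun_eq_iff algebra_simps)
    have f_in: "?f v \<in> coord_space (blk j \<beta> {0})" for v
      using \<beta>0 by (intro emb_in_blk) (auto simp: vsc_def unit_vec_def)
    then show "?f ` Vcar p \<subseteq> coord_space (S \<union> blk j \<beta> {0})"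
      using coord_space_mono[of "blk j \<beta> {0}" "S \<union> blk j \<beta> {0}"] by blast
    show "vdiff (?f (\<rho>V p lam i v)) (\<rho>W p n i (?f v)) \<in> coord_space S" if "i < p" for i v
    proof -
      \<comment> \<open>The coefficient at \<open>v_0\<close> can only come from
        \<open>v_(i-1)\<close>, where the binomial \<open>(i - 1) choose i\<close> is 0 and the
        second term carries the factor \<open>lam = 0\<close>.\<close>
      have "\<rho>V p lam i v 0 = 0" using lam by (simp add: \<rho>V_def cV_def binomial_eq_0)
      then have "?f (\<rho>V p lam i v) = vzero" by (simp add: emb_def vdefs fun_eq_iff)
      moreover have "act p 0 i (vsc (v 0) (unit_vec 0)) = vzero"
        by (auto simp: act_def vdefs unit_vec_def fun_eq_iff)
      then have "\<rho>W p n i (?f v) = vzero"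
        using \<rho>W_emb[OF j(2) \<beta> that, of "vsc (v 0) (unit_vec 0)"] j(1) by (simp add: emb_lin)
      ultimately show ?thesis by (simp add: coord_space_def vdefs)
    qed
    fix m :: "_ \<Rightarrow> 'a" assume m: "m \<in> coord_space (S \<union> blk j \<beta> {0})"
    have "(j, \<beta>) \<in> blk j \<beta> {0}" "blk j \<beta> {0} = {(j, \<beta>)}"
      using \<beta>0 by (auto simp: blk_def fun_eq_iff)
    moreover have "?f (vsc (m (j, \<beta>)) (unit_vec 0)) (j, \<beta>) = m (j, \<beta>)"
      using \<beta>0 p_gt_2 by (auto simp: emb_def vdefs unit_vec_def fun_eq_iff)
    moreover have "?f v q = 0" "m q = 0" if "q \<notin> S" "q \<notin> blk j \<beta> {0}" for v q
      using f_in[of v] m that unfolding coord_space_def by blast+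
    ultimately have "vdiff m (?f (vsc (m (j, \<beta>)) (unit_vec 0))) q = 0" if "q \<notin> S" for q
      using that unfolding vdiff_def by (cases "q = (j, \<beta>)") auto
    then have "vdiff m (?f (vsc (m (j, \<beta>)) (unit_vec 0))) \<in> coord_space S"
      unfolding coord_space_def by blast
    moreover have "vsc (m (j, \<beta>)) (unit_vec 0) \<in> Vcar p"
      using p_gt_2 by (intro subspace_vsc subspace_Vcar unit_vec_in_Vcar) auto
    ultimately show "\<exists>v\<in>Vcar p. vdiff m (?f v) \<in> coord_space S" by blast
  qed
next
  assume "is_L_sq p lam (\<rho>W p n) WC (coord_space S) (coord_space (S \<union> blk j \<beta> {0}))"
  then obtain c where c: "c \<in> {0::nat}" "of_nat c - of_bool (j = 0) = (of_nat lam :: 'a)"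
    using is_L_sq_block_weight[of lam S j \<beta> "{0}"] j \<beta> S(3) p_gt_2 by auto
  then show "lam = 0" using j of_nat_neq_0[of lam] lam by auto
qed

end

section \<open>Decomposition and composition factors\<close>

text \<open>The components are the restrictions to the pieces of the partition. Requiring
  \<open>k t = vzero\<close> beyond \<open>N\<close> makes the family unique as a function on all
  natural numbers.\<close>

lemma coord_space_direct_sum:
  fixes Q :: "nat \<Rightarrow> 'b set" and w :: "'b \<Rightarrow> 'a::field"
  assumes cover: "\<And>q. q \<in> I \<Longrightarrow> \<exists>t<N. q \<in> Q t"
    and disj: "\<And>q t t'. t < N \<Longrightarrow> t' < N \<Longrightarrow> q \<in> Q t \<Longrightarrow> q \<in> Q t' \<Longrightarrow> t = t'"
    and w: "w \<in> coord_space I" and sub: "\<And>t. t < N \<Longrightarrow> Q t \<subseteq> I"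
  shows "\<exists>!k. (\<forall>t<N. k t \<in> coord_space (Q t)) \<and> (\<forall>t\<ge>N. k t = vzero) \<and> w = vsum k N"
proof -
  have sum_at: "vsum k N q = k t q" if "\<forall>t<N. k t \<in> coord_space (Q t)" "t < N" "q \<in> Q t"
    for k :: "nat \<Rightarrow> 'b \<Rightarrow> 'a" and t q
  proof -
    have "(\<Sum>t'<N. k t' q) = (\<Sum>t'<N. if t' = t then k t q else 0)"
    proof (rule sum.cong)
      fix t' assume t': "t' \<in> {..<N}"
      show "k t' q = (if t' = t then k t q else 0)"
      proof (cases "t' = t")
        case False
        then have "q \<notin> Q t'" using disj[of t' t q] that t' by auto
        moreover have "k t' \<in> coord_space (Q t')" using that t' by simp
        ultimately show ?thesis using False unfolding coord_space_def by simp
      qed simp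
    qed simp
    also have "\<dots> = k t q" using that by simp
    finally show ?thesis by (simp add: vsum_def)
  qed
  show ?thesis
  proof (rule ex1I)
    let ?k = "\<lambda>t. if t < N then restr (Q t) w else vzero"
    have k: "\<forall>t<N. ?k t \<in> coord_space (Q t)" by (simp add: restr_in_coord_space)
    have "w q = vsum ?k N q" for q
    proof (cases "q \<in> I")
      case True
      then obtain t where t: "t < N" "q \<in> Q t" using cover by blast
      then show ?thesis using sum_at[OF k t] by (simp add: restr_def)
    next
      case False
      then have "w q = 0" using w unfolding coord_space_def by blast
      moreover have "restr (Q t) w q = 0" if "t < N" for t
        using False sub[OF that] by (auto simp: restr_def)
      then have "vsum ?k N q = 0" by (simp add: vsum_def)
      ultimately show ?thesis by simp
    qed
    then show "(\<forall>t<N. ?k t \<in> coord_space (Q t)) \<and> (\<forall>t\<ge>N. ?k t = vzero) \<and> w = vsum ?k N"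
      using k by auto
    fix k assume k': "(\<forall>t<N. k t \<in> coord_space (Q t)) \<and> (\<forall>t\<ge>N. k t = vzero) \<and> w = vsum k N"
    show "k = ?k"
    proof (intro ext)
      fix t q
      show "k t q = ?k t q"
      proof (cases "t < N")
        case True
        then have kt: "k t \<in> coord_space (Q t)" using k' by blast
        show ?thesis
        proof (cases "q \<in> Q t")
          case in_Q: True
          then show ?thesis using sum_at[of k t q] k' True by (simp add: restr_def)
        next
          case False
          then show ?thesis using kt True by (simp add: restr_def coord_space_def)
        qed
      qed (use k' in simp)
    qed
  qed
qed

lemma card_parity_lt: "card {u. u < 2 * a \<and> even u} = a" "card {u. u < 2 * a \<and> odd u} = (a :: nat)"
proof -
  have "{u. u < 2 * a \<and> even u} = (\<lambda>t. 2 * t) ` {..<a}"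
    by (auto elim!: evenE)
  then show "card {u. u < 2 * a \<and> even u} = a"
    by (simp add: card_image inj_on_def)
  have "{u. u < 2 * a \<and> odd u} = (\<lambda>t. 2 * t + 1) ` {..<a}"
    by (auto elim!: oddE)
  then show "card {u. u < 2 * a \<and> odd u} = a"
    by (simp add: card_image inj_on_def)
qed

section \<open>Numbering of the blocks and the explicit series\<close>

context witt_setting
begin

definition nA :: nat where "nA = (n - 1) * p ^ (n - 1)"
definition nW :: nat where "nW = p ^ (n - 1)"
definition Ablocks :: "(nat \<times> (nat \<Rightarrow> nat)) set" where "Ablocks = {1..<n} \<times> Mon0 p n"

lemma card_Ablocks: "card Ablocks = nA"
  using p_gt_2 by (simp add: Ablocks_def nA_def card_cartesian_product card_Mon0)

lemma finite_Ablocks: "finite Ablocks"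
  by (simp add: Ablocks_def finite_Mon0)

lemma Mon0_upd: "\<gamma> \<in> Mon p n \<Longrightarrow> \<gamma>(0 := 0) \<in> Mon0 p n"
  using n_pos p_gt_2 by (simp add: Mon0_def Mon_upd0)

lemma decomposition:
  "\<exists>K :: nat \<Rightarrow> (nat \<times> (nat \<Rightarrow> nat) \<Rightarrow> 'a) set.
     (\<forall>t < nA + nW. submodule p (\<rho>W p n) WC (K t)) \<and>
     (\<forall>t < nA. iso_V p (p - 1) (\<rho>W p n) (K t)) \<and>
     (\<forall>t. nA \<le> t \<and> t < nA + nW \<longrightarrow> is_L_sq p (p - 2) (\<rho>W p n) WC {vzero} (K t)) \<and>
     (\<forall>w \<in> WC. \<exists>!k. (\<forall>t < nA + nW. k t \<in> K t) \<and> (\<forall>t \<ge> nA + nW. k t = vzero) \<and> w = vsum k (nA + nW))"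
proof -
  obtain hA where hA: "bij_betw hA {0..<nA} Ablocks"
    using ex_bij_betw_nat_finite[OF finite_Ablocks] card_Ablocks by auto
  obtain hW where hW: "bij_betw hW {0..<nW} (Mon0 p n)"
    using ex_bij_betw_nat_finite[OF finite_Mon0[of p n]] card_Mon0[of p n] p_gt_2 by (auto simp: nW_def)
  \<comment> \<open>The numbering puts all copies of \<open>V(p - 1)\<close> before the copies of
    \<open>L(p - 2)\<close>.\<close>
  define h where "h t = (if t < nA then hA t else (0, hW (t - nA)))" for t
  define Q where "Q t = blk (fst (h t)) (snd (h t)) {..<p}" for t
  have hA_in: "t < nA \<Longrightarrow> hA t \<in> Ablocks" for t using hA by (auto simp: bij_betw_def)
  have hW_in: "t < nW \<Longrightarrow> hW t \<in> Mon0 p n" for t using hW by (auto simp: bij_betw_def)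
  have hA_b: "fst (h t) \<in> {1..<n}" "snd (h t) \<in> Mon0 p n" if "t < nA" for t
    using that hA_in[OF that] by (auto simp: h_def Ablocks_def)
  have hW_b: "fst (h t) = 0" "snd (h t) \<in> Mon0 p n" if "nA \<le> t" "t < nA + nW" for t
    using that hW_in[of "t - nA"] by (auto simp: h_def)
  have h_b: "fst (h t) < n" "snd (h t) \<in> Mon0 p n" "snd (h t) 0 = 0" if "t < nA + nW" for t
    using that hA_b[of t] hW_b[of t] n_pos by (cases "t < nA"; force simp: Mon0_def)+
  have h_inj: "t = t'" if "t < nA + nW" "t' < nA + nW" "h t = h t'" for t t'
  proof (cases "t < nA")
    case True
    then have "t' < nA" using that hA_b(1)[of t] hW_b(1)[of t'] by (cases "t' < nA") auto
    then show ?thesis using True that hA by (auto simp: h_def bij_betw_def inj_on_def)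
  next
    case False
    then have "\<not> t' < nA" using that hA_b(1)[of t'] hW_b(1)[of t] by auto
    then have "hW (t - nA) = hW (t' - nA)" using False that by (auto simp: h_def)
    moreover have "t - nA \<in> {0..<nW}" "t' - nA \<in> {0..<nW}" using that False \<open>\<not> t' < nA\<close> by auto
    ultimately have "t - nA = t' - nA" using hW by (auto simp: bij_betw_def inj_on_def)
    then show ?thesis using False \<open>\<not> t' < nA\<close> by simp
  qed
  have Q_iff: "(j, \<gamma>) \<in> Q t \<longleftrightarrow> h t = (j, \<gamma>(0 := 0)) \<and> \<gamma> 0 < p" if "t < nA + nW" for t j \<gamma>
    using h_b(3)[OF that] unfolding Q_def by (auto simp: blk_iff prod_eq_iff)
  have Q_sub: "Q t \<subseteq> Idx p n" if "t < nA + nW" for t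
    unfolding Q_def using h_b[OF that] by (intro blk_subset_Idx) auto
  have cover: "\<exists>t<nA + nW. q \<in> Q t" if q_in: "q \<in> Idx p n" for q
  proof -
    obtain j \<gamma> where q: "q = (j, \<gamma>)" "j < n" "\<gamma> \<in> Mon p n" using q_in by (auto simp: Idx_def)
    have g: "\<gamma>(0 := 0) \<in> Mon0 p n" "\<gamma> 0 < p" using q Mon0_upd Mon_lt n_pos by auto
    show ?thesis
    proof (cases "j = 0")
      case True
      have "\<gamma>(0 := 0) \<in> hW ` {0..<nW}" using hW g by (simp add: bij_betw_def)
      then obtain t where "t < nW" "hW t = \<gamma>(0 := 0)" by auto
      then have "nA + t < nA + nW" "h (nA + t) = (j, \<gamma>(0 := 0))" using True by (auto simp: h_def)
      then show ?thesis using Q_iff[of "nA + t"] q g by blast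
    next
      case False
      then have "(j, \<gamma>(0 := 0)) \<in> hA ` {0..<nA}" using hA g q by (simp add: bij_betw_def Ablocks_def)
      then obtain t where "t < nA" "hA t = (j, \<gamma>(0 := 0))" by auto
      then have "t < nA + nW" "h t = (j, \<gamma>(0 := 0))" by (auto simp: h_def)
      then show ?thesis using Q_iff[of t] q g by blast
    qed
  qed
  have disj: "t = t'" if "t < nA + nW" "t' < nA + nW" "q \<in> Q t" "q \<in> Q t'" for q t t'
    using that h_inj[of t t'] Q_iff by (cases q) auto
  show ?thesis
  proof (intro exI[of _ "\<lambda>t. coord_space (Q t)"] conjI allI impI ballI)
    fix t assume "t < nA + nW"
    then show "submodule p (\<rho>W p n) WC (coord_space (Q t))"
      using Q_sub[of t] h_b(3)[of t] shift_closed_blk unfolding Q_def by (intro submodule_coord_space) auto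
  next
    fix t assume "t < nA"
    then show "iso_V p (p - 1) (\<rho>W p n) (coord_space (Q t) :: (_ \<Rightarrow> 'a) set)"
      unfolding Q_def using hA_b[of t] by (intro iso_V_block) auto
  next
    fix t assume t: "nA \<le> t \<and> t < nA + nW"
    then show "is_L_sq p (p - 2) (\<rho>W p n) WC {vzero} (coord_space (Q t))"
      using is_L_sq_block_W[of "{}" "snd (h t)" "p - 2"] hW_b[of t] shift_closed_empty p_gt_2
      by (simp add: Q_def coord_space_empty)
  next
    fix w :: "_ \<Rightarrow> 'a" assume "w \<in> WC"
    then show "\<exists>!k. (\<forall>t < nA + nW. k t \<in> coord_space (Q t)) \<and> (\<forall>t \<ge> nA + nW. k t = vzero) \<and> w = vsum k (nA + nW)"
      using cover disj Q_sub unfolding Wcar_eq by (intro coord_space_direct_sum[where I = "Idx p n"]) auto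
  qed
qed

text \<open>The factors in the order of the explicit series: every function block takes two
  consecutive steps, the constants at an even index and the quotient by them at the next; the
  adjoint blocks follow, one step each.\<close>

definition label :: "nat \<Rightarrow> nat" where
  "label u = (if u < 2 * nA then (if even u then 0 else p - 1) else p - 2)"

text \<open>For \<open>p > 2\<close> the labels 0, \<open>p - 2\<close> and \<open>p - 1\<close> are
  pairwise distinct, so at most one summand of \<open>mult_L\<close> is active.\<close>

lemma card_label:
  assumes "lam < p"
  shows "card {u. u < 2 * nA + nW \<and> lam = label u} = mult_L p n lam"
proof -
  consider "lam = 0" | "lam = p - 1" | "lam = p - 2" | "lam \<noteq> 0" "lam \<noteq> p - 1" "lam \<noteq> p - 2" by blast
  then show ?thesis
  proof cases
    case 1
    then have "{u. u < 2 * nA + nW \<and> lam = label u} = {u. u < 2 * nA \<and> even u}"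
      using p_gt_2 by (auto simp: label_def)
    then show ?thesis using 1 p_gt_2 by (simp add: card_parity_lt mult_L_def nA_def)
  next
    case 2
    then have "{u. u < 2 * nA + nW \<and> lam = label u} = {u. u < 2 * nA \<and> odd u}"
      using p_gt_2 by (auto simp: label_def)
    then show ?thesis using 2 p_gt_2 by (simp add: card_parity_lt mult_L_def nA_def)
  next
    case 3
    then have "{u. u < 2 * nA + nW \<and> lam = label u} = {2 * nA..<2 * nA + nW}"
      using p_gt_2 by (auto simp: label_def)
    then show ?thesis using 3 p_gt_2 by (simp add: mult_L_def nW_def)
  next
    case 4
    then have "{u. u < 2 * nA + nW \<and> lam = label u} = {}"
      by (auto simp: label_def)
    then show ?thesis using 4 by (simp add: mult_L_def)
  qed
qed

text \<open>Each monomial gets a rank, the step at which it enters, and the \<open>u\<close>-th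
  submodule is spanned by the monomials of rank below \<open>u\<close>. Each step then adds a single
  layer of a single block.\<close>

lemma labelled_series:
  "\<exists>N :: nat \<Rightarrow> (nat \<times> (nat \<Rightarrow> nat) \<Rightarrow> 'a) set. N 0 = {vzero} \<and> N (2 * nA + nW) = WC \<and>
     (\<forall>u < 2 * nA + nW. \<forall>lam < p. is_L_sq p lam (\<rho>W p n) WC (N u) (N (Suc u)) \<longleftrightarrow> lam = label u)"
proof -
  obtain gA where "bij_betw gA Ablocks {0..<nA}"
    using ex_bij_betw_finite_nat[OF finite_Ablocks] card_Ablocks by auto
  then have gA: "inj_on gA Ablocks" "gA ` Ablocks = {0..<nA}" by (auto simp: bij_betw_def)
  obtain gW where "bij_betw gW (Mon0 p n) {0..<nW}"
    using ex_bij_betw_finite_nat[OF finite_Mon0[of p n]] card_Mon0[of p n] p_gt_2 by (auto simp: nW_def)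
  then have gW: "inj_on gW (Mon0 p n)" "gW ` (Mon0 p n) = {0..<nW}" by (auto simp: bij_betw_def)
  define rk where "rk q = (case q of (j, \<gamma>) \<Rightarrow> if j = 0 then 2 * nA + gW (\<gamma>(0 := 0))
     else 2 * gA (j, \<gamma>(0 := 0)) + of_bool (\<gamma> 0 \<noteq> 0))" for q :: "nat \<times> (nat \<Rightarrow> nat)"
  define S where "S u = {q \<in> Idx p n. rk q < u}" for u
  have gA_lt: "gA (j, \<gamma>(0 := 0)) < nA" if "(j, \<gamma>) \<in> Idx p n" "j \<noteq> 0" for j \<gamma>
  proof -
    have "(j, \<gamma>(0 := 0)) \<in> Ablocks" using that Mon0_upd by (auto simp: Ablocks_def Idx_def)
    then show ?thesis using gA(2) by auto
  qed
  have gW_lt: "gW (\<gamma>(0 := 0)) < nW" if "(j, \<gamma>) \<in> Idx p n" for j \<gamma>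
    using that Mon0_upd[of \<gamma>] gW(2) by (auto simp: Idx_def)
  have S_sub: "S u \<subseteq> Idx p n" for u by (auto simp: S_def)
  \<comment> \<open>Changing the \<open>x_1\<close>-exponent of a monomial that is not constant in
    \<open>x_1\<close> never raises the rank, and in an adjoint block the rank does not depend on
    that exponent.\<close>
  have S_closed: "shift_closed p (S u)" for u
    using n_pos Mon_upd0 unfolding shift_closed_def S_def rk_def Idx_def by fastforce
  have S_Suc: "S (Suc u) = S u \<union> {q \<in> Idx p n. rk q = u}" for u by (auto simp: S_def)
  have S0: "S 0 = {}" by (auto simp: S_def)
  have Sr: "S (2 * nA + nW) = Idx p n"
  proof -
    have "rk q < 2 * nA + nW" if "q \<in> Idx p n" for q
    proof -
      obtain j \<gamma> where q: "q = (j, \<gamma>)" by fastforce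
      show ?thesis using that gA_lt[of j \<gamma>] gW_lt[of j \<gamma>] by (auto simp: q rk_def)
    qed
    then show ?thesis by (auto simp: S_def)
  qed
  have factors: "is_L_sq p lam (\<rho>W p n) WC (coord_space (S u)) (coord_space (S (Suc u))) \<longleftrightarrow> lam = label u"
    if u: "u < 2 * nA + nW" and lam: "lam < p" for u lam
  proof (cases "u < 2 * nA")
    case False
    then have "u - 2 * nA \<in> gW ` Mon0 p n" using u gW(2) by auto
    then obtain \<beta> where \<beta>: "\<beta> \<in> Mon0 p n" "u = 2 * nA + gW \<beta>" using False by auto
    have \<beta>0: "\<beta> 0 = 0" using \<beta> by (simp add: Mon0_def)
    have rk_iff: "q \<in> Idx p n \<and> rk q = u \<longleftrightarrow> q \<in> blk 0 \<beta> {..<p}" for q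
    proof -
      obtain j \<gamma> where q: "q = (j, \<gamma>)" by fastforce
      show ?thesis
      proof
        assume h: "q \<in> Idx p n \<and> rk q = u"
        have "j = 0" using h gA_lt[of j \<gamma>] False by (auto simp: q rk_def of_bool_def split: if_splits)
        then have "gW (\<gamma>(0 := 0)) = gW \<beta>" using h \<beta> by (auto simp: q rk_def)
        then have "\<gamma>(0 := 0) = \<beta>"
          using gW(1) \<beta>(1) Mon0_upd[of \<gamma>] h by (auto simp: q Idx_def inj_on_def)
        then show "q \<in> blk 0 \<beta> {..<p}"
          using \<open>j = 0\<close> h Mon_lt[of \<gamma> p n] n_pos \<beta>0 by (auto simp: q blk_iff Idx_def)
      next
        assume h: "q \<in> blk 0 \<beta> {..<p}"
        then show "q \<in> Idx p n \<and> rk q = u"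
          using blk_subset_Idx[OF n_pos \<beta>(1), of "{..<p}"] \<beta> \<beta>0 by (auto simp: q blk_iff rk_def)
      qed
    qed
    have "S (Suc u) = S u \<union> blk 0 \<beta> {..<p}" using rk_iff unfolding S_Suc by blast
    moreover have "blk 0 \<beta> {..<p} \<inter> S u = {}" using rk_iff unfolding S_def by fastforce
    ultimately show ?thesis
      using is_L_sq_block_W[OF S_sub S_closed _ \<beta>(1) lam] False by (simp add: label_def)
  next
    case True
    then have "u div 2 \<in> gA ` Ablocks" using gA(2) by auto
    then obtain j \<beta> where A: "(j, \<beta>) \<in> Ablocks" "gA (j, \<beta>) = u div 2" by auto
    have j: "0 < j" "j < n" and \<beta>: "\<beta> \<in> Mon0 p n" and \<beta>0: "\<beta> 0 = 0"
      using A by (auto simp: Ablocks_def Mon0_def)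
    \<comment> \<open>The exponent set is \<open>{0}\<close> for even \<open>u\<close> and
      \<open>{1..<p}\<close> for odd \<open>u\<close>; writing it this way treats both layers at
      once.\<close>
    have rk_iff: "q \<in> Idx p n \<and> rk q = u \<longleftrightarrow> q \<in> blk j \<beta> {c. c < p \<and> (c = 0 \<longleftrightarrow> even u)}" for q
    proof -
      obtain j' \<gamma> where q: "q = (j', \<gamma>)" by fastforce
      show ?thesis
      proof
        assume h: "q \<in> Idx p n \<and> rk q = u"
        have "j' \<noteq> 0" using h True by (auto simp: q rk_def split: if_splits)
        then have eq: "2 * gA (j', \<gamma>(0 := 0)) + of_bool (\<gamma> 0 \<noteq> 0) = u" using h by (auto simp: q rk_def)
        then have "gA (j', \<gamma>(0 := 0)) = u div 2" "\<gamma> 0 = 0 \<longleftrightarrow> even u"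
          by (auto simp: of_bool_def split: if_splits)
        moreover have "(j', \<gamma>(0 := 0)) \<in> Ablocks"
          using h Mon0_upd[of \<gamma>] \<open>j' \<noteq> 0\<close> by (auto simp: q Idx_def Ablocks_def)
        ultimately have "(j', \<gamma>(0 := 0)) = (j, \<beta>)"
          using inj_onD[OF gA(1), of "(j', \<gamma>(0 := 0))" "(j, \<beta>)"] A by simp
        then show "q \<in> blk j \<beta> {c. c < p \<and> (c = 0 \<longleftrightarrow> even u)}"
          using \<open>\<gamma> 0 = 0 \<longleftrightarrow> even u\<close> h Mon_lt[of \<gamma> p n] n_pos \<beta>0 by (auto simp: q blk_iff Idx_def)
      next
        assume h: "q \<in> blk j \<beta> {c. c < p \<and> (c = 0 \<longleftrightarrow> even u)}"
        then have "q \<in> Idx p n"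
          using blk_subset_Idx[OF j(2) \<beta>, of "{c. c < p \<and> (c = 0 \<longleftrightarrow> even u)}"] by auto
        moreover have "rk q = u"
        proof -
          have "rk q = 2 * (u div 2) + of_bool (odd u)" using h j A(2) \<beta>0 by (auto simp: q blk_iff rk_def)
          then show ?thesis by (simp add: of_bool_odd_eq_mod_2)
        qed
        ultimately show "q \<in> Idx p n \<and> rk q = u" by simp
      qed
    qed
    have step: "S (Suc u) = S u \<union> blk j \<beta> {c. c < p \<and> (c = 0 \<longleftrightarrow> even u)}"
      using rk_iff unfolding S_Suc by blast
    have disj: "blk j \<beta> {c. c < p \<and> (c = 0 \<longleftrightarrow> even u)} \<inter> S u = {}"
      using rk_iff unfolding S_def by fastforce
    show ?thesis
    proof (cases "even u")
      case ev: True
      have "{c. c < p \<and> (c = 0 \<longleftrightarrow> even u)} = {0}" using ev p_gt_2 by auto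
      then show ?thesis
        using is_L_sq_block_triv[OF S_sub S_closed _ j \<beta> lam, of u] step disj True ev by (simp add: label_def)
    next
      case od: False
      have eq: "{c. c < p \<and> (c = 0 \<longleftrightarrow> even u)} = {1..<p}" using od p_gt_2 by auto
      \<comment> \<open>For odd \<open>u\<close> the constants of the same block entered at step
        \<open>u - 1\<close>, as the layer above them demands.\<close>
      have "rk (j, \<beta>) < u" using j A(2) \<beta>0 od by (simp add: rk_def fun_upd_idem) presburger
      moreover have "(j, \<beta>) \<in> Idx p n" using j \<beta> by (simp add: Idx_def Mon0_def)
      ultimately have "blk j \<beta> {0} \<subseteq> S u" using \<beta>0 by (auto simp: blk_def S_def fun_upd_idem)
      then show ?thesis
        using is_L_sq_block_A[OF S_sub S_closed _ _ j \<beta> lam, of u] step disj True od eq by (simp add: label_def)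
    qed
  qed
  show ?thesis
    using factors by (intro exI[of _ "\<lambda>u. coord_space (S u)"]) (simp add: S0 Sr coord_space_empty Wcar_eq)
qed

text \<open>Each \<open>label u\<close> is below \<open>p\<close>, so every step of the explicit
  series carries a label and is therefore simple. The matching transfers its counts to an arbitrary
  series.\<close>

lemma composition_factors:
  "(\<exists>M r. comp_series p (\<rho>W p n) WC M r) \<and>
   (\<forall>M r. comp_series p (\<rho>W p n) WC M r \<longrightarrow>
     (\<forall>lam < p. card {i. i < r \<and> is_L_sq p lam (\<rho>W p n) WC (M i) (M (Suc i))} = mult_L p n lam))"
proof -
  obtain N :: "nat \<Rightarrow> (nat \<times> (nat \<Rightarrow> nat) \<Rightarrow> 'a) set" where N: "N 0 = {vzero}" "N (2 * nA + nW) = WC"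
    and factors: "\<forall>u < 2 * nA + nW. \<forall>lam < p. is_L_sq p lam (\<rho>W p n) WC (N u) (N (Suc u)) \<longleftrightarrow> lam = label u"
    using labelled_series by blast
  have label_lt: "label u < p" for u using p_gt_2 by (simp add: label_def)
  have "simple_sq p (\<rho>W p n) WC (N u) (N (Suc u))" if "u < 2 * nA + nW" for u
    using factors that label_lt[of u] unfolding is_L_sq_def by blast
  then have cs: "comp_series p (\<rho>W p n) WC N (2 * nA + nW)"
    using N by (simp add: comp_series_def)
  have "card {i. i < r \<and> is_L_sq p lam (\<rho>W p n) WC (M i) (M (Suc i))} = mult_L p n lam"
    if M: "comp_series p (\<rho>W p n) WC M r" and lam: "lam < p" for M r lam
  proof -
    have "card {i. i < r \<and> is_L_sq p lam (\<rho>W p n) WC (M i) (M (Suc i))}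
        = card {u. u < 2 * nA + nW \<and> is_L_sq p lam (\<rho>W p n) WC (N u) (N (Suc u))}"
      by (rule comp_series_card_eq[OF M cs subspace_WC lin_on_\<rho>W])
    also have "{u. u < 2 * nA + nW \<and> is_L_sq p lam (\<rho>W p n) WC (N u) (N (Suc u))}
        = {u. u < 2 * nA + nW \<and> lam = label u}"
      using factors lam by blast
    finally show ?thesis using card_label[OF lam] by simp
  qed
  with cs show ?thesis by blast
qed

end

theorem theorem3p1:
  fixes p n :: nat and ty :: "'a::field itself"
  assumes "prime p" and "p > 2" and "CHAR('a) = p"
    and "\<forall>q :: 'a poly. degree q > 0 \<longrightarrow> (\<exists>x. poly q x = 0)"
    and "n \<ge> 1"
  shows
   "(\<exists>K :: nat \<Rightarrow> (nat \<times> (nat \<Rightarrow> nat) \<Rightarrow> 'a) set.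
       let a = (n - 1) * p ^ (n - 1); b = p ^ (n - 1) in
         (\<forall>t < a + b. submodule p (\<rho>W p n) (Wcar p n) (K t)) \<and>
         (\<forall>t < a. iso_V p (p - 1) (\<rho>W p n) (K t)) \<and>
         (\<forall>t. a \<le> t \<and> t < a + b \<longrightarrow> is_L_sq p (p - 2) (\<rho>W p n) (Wcar p n) {vzero} (K t)) \<and>
         (\<forall>w \<in> Wcar p n. \<exists>!k. (\<forall>t < a + b. k t \<in> K t) \<and> (\<forall>t \<ge> a + b. k t = vzero)
                              \<and> w = vsum k (a + b)))
    \<and> (\<exists>M r. comp_series p (\<rho>W p n) (Wcar p n :: (nat \<times> (nat \<Rightarrow> nat) \<Rightarrow> 'a) set) M r)
    \<and> (\<forall>M r. comp_series p (\<rho>W p n) (Wcar p n :: (nat \<times> (nat \<Rightarrow> nat) \<Rightarrow> 'a) set) M r \<longrightarrow>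
         (\<forall>lam < p. card {i. i < r \<and> is_L_sq p lam (\<rho>W p n) (Wcar p n) (M i) (M (Suc i))}
                      = mult_L p n lam))"
proof -
  interpret witt_setting p n ty
    using assms by unfold_locales auto
  show ?thesis
    using decomposition composition_factors unfolding nA_def nW_def Let_def by blast
qed

end
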